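(* Let $n\ge 2$ and let $\mathcal{T}_n$ be the family of trees on $n$ vertices. Then $$\min_{G \in \mathcal{T}_n} T_{\mathsf{meet}}(G) = T_{\mathsf{meet}}(S_n) = 2n - \frac{7}{2}, \qquad \max_{G \in \mathcal{T}_n} T_{\mathsf{meet}}(G) = T_{\mathsf{meet}}(P_n) = \frac{4n^2-8n+3}{6},$$ and the star $S_n$ and the path $P_n$ are the unique minimizer and maximizer, respectively (up to isomorphism).
   Context: For a connected graph $G=(V,E)$ and simple random walk on $G$ (each step moves to a uniformly random neighbor), $H(u,v)$ is the expected number of steps for the walk from $u$ to reach $v$ ($H(u,u)=0$), $\pi_v=\deg(v)/2|E|$, $H(\pi,w)=\sum_v\pi_v H(v,w)$ and $T_{\mathsf{meet}}(G)=\max_w H(\pi,w)$. $S_n$ is the star on $n$ vertices (one center adjacent to $n-1$ leaves) and $P_n$ is the path on $n$ vertices. *)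

theory Defs
  imports "HOL-Probability.Probability" "Graph_Theory.Digraph_Isomorphism" "Graph_Theory.Pair_Digraph"
begin

section \<open>Trees\<close>

text \<open>
  A finite simple graph is a \<^locale>\<open>pair_graph\<close>: a finite, symmetric, loop-free digraph
  without parallel arcs, in which an undirected edge \<open>{x, y}\<close> is the pair of arcs
  \<open>(x, y)\<close> and \<open>(y, x)\<close>. The library's predicate \<^const>\<open>Digraph_Component.tree\<close>
  cannot be used for such graphs, since \<^const>\<open>pre_digraph.cycle\<close> also admits the closed walk
  \<open>x, y, x\<close> along a single edge; the cycles of the undirected graph are those of length
  at least 3.
\<close>

definition is_tree :: "'a pair_pre_digraph \<Rightarrow> bool" where
  "is_tree G \<longleftrightarrow> pair_graph G \<and> Digraph_Component.connected (with_proj G) \<and>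
     \<not> (\<exists>p. pre_digraph.cycle (with_proj G) p \<and> 3 \<le> length p)"

definition trees_on :: "'a set \<Rightarrow> 'a pair_pre_digraph set" where
  "trees_on V = {G. is_tree G \<and> pverts G = V}"

definition star_graph :: "nat \<Rightarrow> nat pair_pre_digraph" where
  "star_graph n = \<lparr> pverts = {0..<n},
     parcs = {(i, j). i < n \<and> j < n \<and> i \<noteq> j \<and> (i = 0 \<or> j = 0)} \<rparr>"

definition path_graph :: "nat \<Rightarrow> nat pair_pre_digraph" where
  "path_graph n = \<lparr> pverts = {0..<n},
     parcs = {(i, j). i < n \<and> j < n \<and> (j = Suc i \<or> i = Suc j)} \<rparr>"

abbreviation graph_iso :: "'a pair_pre_digraph \<Rightarrow> 'b pair_pre_digraph \<Rightarrow> bool" where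
  "graph_iso G H \<equiv> digraph_iso (with_proj G) (with_proj H)"


section \<open>Simple random walk\<close>

definition neighbors :: "'a pair_pre_digraph \<Rightarrow> 'a \<Rightarrow> 'a set" where
  "neighbors G x = {y. (x, y) \<in> parcs G}"

text \<open>
  The law of the position at time \<open>i\<close> given the trajectory \<open>\<omega>\<close> before time \<open>i\<close>. At a vertex
  without neighbors the value is unspecified; this does not occur in a connected graph with at
  least two vertices.
\<close>

definition srw_step :: "'a pair_pre_digraph \<Rightarrow> 'a \<Rightarrow> nat \<Rightarrow> (nat \<Rightarrow> 'a) \<Rightarrow> 'a measure" where
  "srw_step G u i \<omega> =
     (case i of 0 \<Rightarrow> measure_pmf (return_pmf u)
              | Suc k \<Rightarrow> measure_pmf (pmf_of_set (neighbors G (\<omega> k))))"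

lemma Ionescu_Tulcea_srw_step:
  fixes G :: "'a pair_pre_digraph" and u :: 'a
  shows "Ionescu_Tulcea (srw_step G u) (\<lambda>_. count_space UNIV)"
proof (rule Ionescu_Tulcea.intro)
  fix i :: nat
  show "srw_step G u i \<in> measurable (PiM {0..<i} (\<lambda>_. count_space UNIV))
          (subprob_algebra (count_space UNIV))"
  proof (cases i)
    case 0
    then show ?thesis
      by (simp add: srw_step_def[abs_def] measure_pmf_in_subprob_algebra)
  next
    case (Suc k)
    have "(\<lambda>\<omega>. \<omega> k) \<in> measurable (PiM {0..<i} (\<lambda>_. count_space UNIV)) (count_space UNIV)"
      using Suc by (intro measurable_component_singleton) auto
    moreover have "(\<lambda>x. measure_pmf (pmf_of_set (neighbors G x)))
        \<in> measurable (count_space UNIV) (subprob_algebra (count_space UNIV))"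
      by (simp add: measure_pmf_in_subprob_algebra)
    ultimately show ?thesis
      using Suc by (simp add: srw_step_def[abs_def] measurable_compose)
  qed
next
  fix i :: nat and \<omega> :: "nat \<Rightarrow> 'a"
  show "prob_space (srw_step G u i \<omega>)"
    by (auto simp: srw_step_def measure_pmf.prob_space_axioms split: nat.split)
qed

global_interpretation srw: Ionescu_Tulcea "srw_step G u" "\<lambda>_. count_space UNIV"
  for G :: "'a pair_pre_digraph" and u :: 'a
  by (rule Ionescu_Tulcea_srw_step)

text \<open>The law, on the space of infinite trajectories, of simple random walk started at \<open>u\<close>.\<close>

definition srw :: "'a pair_pre_digraph \<Rightarrow> 'a \<Rightarrow> (nat \<Rightarrow> 'a) measure" where
  "srw G u = srw.PF.lim G u"

text \<open>The infimum is \<open>\<infinity>\<close> on the event that \<open>v\<close> is never reached.\<close>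

definition reach_time :: "'a \<Rightarrow> (nat \<Rightarrow> 'a) \<Rightarrow> enat" where
  "reach_time v \<omega> = (INF k \<in> {k. \<omega> k = v}. enat k)"

definition hitting_time :: "'a pair_pre_digraph \<Rightarrow> 'a \<Rightarrow> 'a \<Rightarrow> ennreal" where
  "hitting_time G u v = (\<integral>\<^sup>+\<omega>. ennreal_of_enat (reach_time v \<omega>) \<partial>srw G u)"

text \<open>Every edge contributes two arcs, so \<open>card (parcs G)\<close> is \<open>2|E|\<close>.\<close>

definition stationary :: "'a pair_pre_digraph \<Rightarrow> 'a \<Rightarrow> real" where
  "stationary G v = real (out_degree (with_proj G) v) / real (card (parcs G))"

definition stationary_hitting_time :: "'a pair_pre_digraph \<Rightarrow> 'a \<Rightarrow> ennreal" where
  "stationary_hitting_time G w = (\<Sum>v\<in>pverts G. ennreal (stationary G v) * hitting_time G v w)"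

definition T_meet :: "'a pair_pre_digraph \<Rightarrow> ennreal" where
  "T_meet G = Max (stationary_hitting_time G ` pverts G)"

end

theory Submission
  imports Defs
begin

text \<open>
  Root a tree on \<open>n\<close> vertices at \<open>w\<close> and let \<open>s u\<close> be the size of the subtree below \<open>u\<close>. The walk
  needs on average \<open>2 s u - 1\<close> steps from \<open>u\<close> to its parent, and the subtree below \<open>u\<close> has degree
  sum \<open>2 s u - 1\<close>; exchanging summations gives
  \<open>H(\<pi>, w) = (\<Sum>u\<noteq>w. (2 s u - 1)\<^sup>2) / (2 (n - 1))\<close>.
  If parents precede children in an enumeration of the vertices starting from \<open>w\<close> with index \<open>0\<close>,
  then the subtree of the \<open>i\<close>-th vertex has size at most \<open>n - i\<close>, with equality throughout only for a
  path with end \<open>w\<close>. If \<open>w\<close> is a leaf, its neighbour has \<open>s = n - 1\<close> and all other vertices have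
  \<open>s \<ge> 1\<close>, with equality throughout only for a star.
\<close>

section \<open>First-step analysis of hitting times\<close>

text \<open>The transition operator of the walk. As an integral against the kernel used in
  \<open>srw_step\<close>, it makes sense before anything is known about the size of the
  neighbourhood.\<close>

definition nb_mean :: "'a pair_pre_digraph \<Rightarrow> ('a \<Rightarrow> ennreal) \<Rightarrow> 'a \<Rightarrow> ennreal" where
  "nb_mean G h x = (\<integral>\<^sup>+y. h y \<partial>measure_pmf (pmf_of_set (neighbors G x)))"

text \<open>The probability that the walk from \<open>x\<close> avoids \<open>v\<close> at all times
  from \<open>0\<close> to \<open>k\<close>, both included, computed by conditioning on the first
  step.\<close>

primrec survival :: "'a pair_pre_digraph \<Rightarrow> 'a \<Rightarrow> nat \<Rightarrow> 'a \<Rightarrow> ennreal" where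
  "survival G v 0 x = (if x = v then 0 else 1)"
| "survival G v (Suc k) x = (if x = v then 0 else nb_mean G (survival G v k) x)"

section \<open>Laws of finite initial segments of the walk\<close>

abbreviation traj :: "nat set \<Rightarrow> (nat \<Rightarrow> 'a) measure" where
  "traj J \<equiv> PiM J (\<lambda>_. count_space UNIV)"

lemma measurable_traj_component:
  assumes "i \<in> J" and "f \<in> measurable (count_space UNIV) N"
  shows "(\<lambda>\<omega>. f (\<omega> i)) \<in> measurable (traj J) N"
  by (rule measurable_compose[OF measurable_component_singleton[OF assms(1)] assms(2)])

lemma measurable_avoid:
  assumes "{..k} \<subseteq> J"
  shows "(\<lambda>\<omega>. if \<forall>i\<le>k. \<omega> i \<noteq> v then g (\<omega> k) else (0::ennreal)) \<in> borel_measurable (traj J)"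
proof -
  have "(\<lambda>\<omega>. g (\<omega> k)) \<in> borel_measurable (traj J)"
    using assms by (intro measurable_traj_component[where f=g]) auto
  moreover have "{\<omega> \<in> space (traj J). \<forall>i\<le>k. \<omega> i \<noteq> v} \<in> sets (traj J)"
  proof -
    have "Measurable.pred (traj J) (\<lambda>\<omega>. \<omega> i \<noteq> v)" if "i \<le> k" for i
      using assms that by (intro measurable_traj_component[where f="\<lambda>x. x \<noteq> v"]) auto
    then have "Measurable.pred (traj J) (\<lambda>\<omega>. \<forall>i\<in>{..k}. \<omega> i \<noteq> v)"
      by (intro pred_intros_finite(3)) auto
    then show ?thesis
      by (simp only: pred_def Ball_def atMost_iff)
  qed
  ultimately show ?thesis
    by (intro measurable_If borel_measurable_const)
qed

lemma sets_srw: "sets (srw G u) = sets (traj UNIV)"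
  by (simp add: srw_def)

text \<open>The projective limit has the iterated kernels as its finite marginals, so an integrand
  that sees only the first \<open>n\<close> positions can be integrated against the law of those
  positions.\<close>

lemma nn_integral_srw_finite:
  assumes "f \<in> borel_measurable (traj {0..<n})"
  shows "(\<integral>\<^sup>+\<omega>. f (restrict \<omega> {0..<n}) \<partial>srw G u) = (\<integral>\<^sup>+\<omega>. f \<omega> \<partial>srw.C G u 0 n (\<lambda>_. undefined))"
proof -
  \<comment> \<open>\<open>srw.distr_lim\<close> describes the marginal on an index set through the
    shortest initial segment containing it; for \<open>{0..<n}\<close> that segment has length
    \<open>n\<close>.\<close>
  have up: "srw.up_to {0..<n} = n"
    using srw.up_to[of "{0..<n}"] srw.up_to_iff_Ico[of "{0..<n}" n] by (auto intro: antisym)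
  have "distr (srw G u) (traj {0..<n}) (\<lambda>\<omega>. restrict \<omega> {0..<n}) = srw.C G u 0 n (\<lambda>_. undefined)"
    using srw.distr_C[of n n "\<lambda>_. undefined" 0 G u]
    by (simp add: srw_def srw.distr_lim srw.CI_def up)
  moreover have "(\<integral>\<^sup>+\<omega>. f (restrict \<omega> {0..<n}) \<partial>srw G u) =
      (\<integral>\<^sup>+\<omega>. f \<omega> \<partial>distr (srw G u) (traj {0..<n}) (\<lambda>\<omega>. restrict \<omega> {0..<n}))"
    using assms
    by (intro nn_integral_distr[symmetric])
      (simp_all add: measurable_cong_sets[OF sets_srw refl] measurable_restrict_subset del: restrict_apply)
  ultimately show ?thesis by simp
qed

text \<open>The law of \<open>Suc n\<close> positions is the law of \<open>n\<close> positions
  followed by one more kernel step, so the last position can be integrated out first.\<close>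

lemma nn_integral_C_Suc:
  assumes "f \<in> borel_measurable (traj {0..<Suc n})"
  shows "(\<integral>\<^sup>+\<omega>. f \<omega> \<partial>srw.C G u 0 (Suc n) (\<lambda>_. undefined)) =
    (\<integral>\<^sup>+\<omega>. (\<integral>\<^sup>+x. f (fun_upd \<omega> n x) \<partial>srw_step G u n \<omega>) \<partial>srw.C G u 0 n (\<lambda>_. undefined))"
proof -
  have sp: "(\<lambda>_. undefined) \<in> space (traj {0..<0})" by (simp add: space_PiM)
  have "(\<integral>\<^sup>+\<omega>. f \<omega> \<partial>srw.C G u 0 (Suc n) (\<lambda>_. undefined)) =
    (\<integral>\<^sup>+\<omega>. (\<integral>\<^sup>+x. f x \<partial>srw.eP G u n \<omega>) \<partial>srw.C G u 0 n (\<lambda>_. undefined))"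
    using assms srw.measurable_eP[of G u n]
    by (simp add: nn_integral_bind[where B="traj {0..<Suc n}"]
        measurable_cong_sets[OF srw.sets_C[OF sp] refl])
  also have "\<dots> = (\<integral>\<^sup>+\<omega>. (\<integral>\<^sup>+x. f (fun_upd \<omega> n x) \<partial>srw_step G u n \<omega>) \<partial>srw.C G u 0 n (\<lambda>_. undefined))"
    using assms by (intro nn_integral_cong srw.nn_integral_eP) (simp_all add: srw.space_C[OF sp])
  finally show ?thesis .
qed

text \<open>
  The walk is built by appending steps, whereas \<^const>\<open>survival\<close> conditions on the first one;
  iterating a single operator makes the two orders agree.
\<close>

lemma nn_integral_avoid:
  fixes G :: "'a pair_pre_digraph" and v :: 'a and g :: "'a \<Rightarrow> ennreal"
  defines "K \<equiv> \<lambda>h. nb_mean G (\<lambda>y. if y = v then 0 else h y)"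
  shows "(\<integral>\<^sup>+\<omega>. (if \<forall>i\<le>k. \<omega> i \<noteq> v then g (\<omega> k) else 0) \<partial>srw.C G u 0 (Suc k) (\<lambda>_. undefined)) =
    (if u = v then 0 else (K ^^ k) g u)"
proof (induction k arbitrary: g)
  case 0
  have sp: "(\<lambda>_. undefined) \<in> space (traj {0..<0})" by (simp add: space_PiM)
  have "(\<integral>\<^sup>+\<omega>. (if \<forall>i\<le>0. \<omega> i \<noteq> v then g (\<omega> 0) else 0) \<partial>srw.C G u 0 (Suc 0) (\<lambda>_. undefined)) =
    (\<integral>\<^sup>+\<omega>. (\<integral>\<^sup>+x. (if x \<noteq> v then g x else 0) \<partial>srw_step G u 0 \<omega>) \<partial>srw.C G u 0 0 (\<lambda>_. undefined))"
    by (subst nn_integral_C_Suc[OF measurable_avoid]) (auto cong: if_cong)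
  also have "\<dots> = (if u = v then 0 else g u)"
    using sp by (simp add: srw_step_def nn_integral_return)
  finally show ?case by simp
next
  case (Suc k)
  have "(\<integral>\<^sup>+\<omega>. (if \<forall>i\<le>Suc k. \<omega> i \<noteq> v then g (\<omega> (Suc k)) else 0)
        \<partial>srw.C G u 0 (Suc (Suc k)) (\<lambda>_. undefined)) =
    (\<integral>\<^sup>+\<omega>. (\<integral>\<^sup>+x. (if \<forall>i\<le>Suc k. (fun_upd \<omega> (Suc k) x) i \<noteq> v then g x else 0)
        \<partial>srw_step G u (Suc k) \<omega>) \<partial>srw.C G u 0 (Suc k) (\<lambda>_. undefined))"
    by (subst nn_integral_C_Suc[OF measurable_avoid]) (auto cong: if_cong)
  \<comment> \<open>Integrating out the last position replaces \<open>g\<close> by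
    \<open>K g\<close>, evaluated one time earlier; this is why the induction is over arbitrary
    \<open>g\<close>.\<close>
  also have "\<dots> = (\<integral>\<^sup>+\<omega>. (if \<forall>i\<le>k. \<omega> i \<noteq> v then K g (\<omega> k) else 0)
        \<partial>srw.C G u 0 (Suc k) (\<lambda>_. undefined))"
  proof (intro nn_integral_cong)
    fix \<omega>
    have *: "(\<forall>i\<le>Suc k. fun_upd \<omega> (Suc k) x i \<noteq> v) \<longleftrightarrow> (\<forall>i\<le>k. \<omega> i \<noteq> v) \<and> x \<noteq> v" for x
      by (auto simp: le_Suc_eq)
    show "(\<integral>\<^sup>+x. (if \<forall>i\<le>Suc k. fun_upd \<omega> (Suc k) x i \<noteq> v then g x else 0)
        \<partial>srw_step G u (Suc k) \<omega>) = (if \<forall>i\<le>k. \<omega> i \<noteq> v then K g (\<omega> k) else 0)"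
    proof (cases "\<forall>i\<le>k. \<omega> i \<noteq> v")
      case True
      then show ?thesis
        unfolding * by (auto simp: srw_step_def K_def nb_mean_def intro!: nn_integral_cong)
    next
      case False
      show ?thesis
        unfolding * by (simp only: False simp_thms if_False nn_integral_const) simp
    qed
  qed
  also have "\<dots> = (if u = v then 0 else (K ^^ k) (K g) u)"
    by (rule Suc.IH)
  finally show ?case by (simp add: funpow_swap1)
qed

text \<open>Killing at \<open>v\<close> happens outside the mean in \<open>survival\<close> and
  inside it in the iterated operator. The outer case distinction on the starting point makes up for
  the shift.\<close>

lemma survival_eq_funpow:
  "survival G v k u =
    (if u = v then 0 else ((\<lambda>h. nb_mean G (\<lambda>y. if y = v then 0 else h y)) ^^ k) (\<lambda>_. 1) u)"
proof (induction k arbitrary: u)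
  case (Suc k)
  have "survival G v k = (\<lambda>u. if u = v then 0
      else ((\<lambda>h. nb_mean G (\<lambda>y. if y = v then 0 else h y)) ^^ k) (\<lambda>_. 1) u)"
    using Suc.IH by blast
  then show ?case by simp
qed simp

text \<open>Pathwise tail-sum formula: a trajectory first reaching \<open>v\<close> at time
  \<open>m\<close> contributes 1 exactly for \<open>k < m\<close>, and one that never reaches
  \<open>v\<close> makes both sides infinite.\<close>

lemma ennreal_of_enat_reach_time:
  "ennreal_of_enat (reach_time v \<omega>) = (\<Sum>k. if \<forall>i\<le>k. \<omega> i \<noteq> v then 1 else 0)"
proof (cases "\<exists>k. \<omega> k = v")
  case True
  define m where "m = (LEAST k. \<omega> k = v)"
  have m: "\<omega> m = v" unfolding m_def using True by (rule LeastI_ex)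
  have m_min: "m \<le> k" if "\<omega> k = v" for k unfolding m_def using that by (rule Least_le)
  have "reach_time v \<omega> = enat m"
    unfolding reach_time_def using m m_min by (intro antisym INF_lower INF_greatest) auto
  moreover have "(\<forall>i\<le>k. \<omega> i \<noteq> v) \<longleftrightarrow> k < m" for k
  proof
    show "\<forall>i\<le>k. \<omega> i \<noteq> v \<Longrightarrow> k < m" using m leI by blast
    show "k < m \<Longrightarrow> \<forall>i\<le>k. \<omega> i \<noteq> v" using m_min by fastforce
  qed
  moreover have "(\<Sum>k. if k < m then 1 else 0 :: ennreal) = of_nat m"
    by (subst suminf_finite[of "{..<m}"]) auto
  ultimately show ?thesis by simp
next
  case False
  then have "reach_time v \<omega> = \<infinity>" by (simp add: reach_time_def top_enat_def)
  moreover have "(\<Sum>k. 1 :: ennreal) = \<infinity>"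
    by (simp add: suminf_eq_SUP ennreal_SUP_of_nat_eq_top)
  ultimately show ?thesis using False by simp
qed

lemma hitting_time_eq_suminf_survival: "hitting_time G u v = (\<Sum>k. survival G v k u)"
proof -
  let ?f = "\<lambda>k \<omega>. if \<forall>i\<le>k. \<omega> i \<noteq> v then 1 else (0::ennreal)"
  have "hitting_time G u v = (\<Sum>k. \<integral>\<^sup>+\<omega>. ?f k \<omega> \<partial>srw G u)"
    unfolding hitting_time_def ennreal_of_enat_reach_time
    by (intro nn_integral_suminf) (simp add: measurable_cong_sets[OF sets_srw refl]
        measurable_avoid[where g="\<lambda>_. 1"])
  also have "\<dots> = (\<Sum>k. survival G v k u)"
  proof (intro arg_cong[where f=suminf] ext)
    fix k
    have "(\<integral>\<^sup>+\<omega>. ?f k \<omega> \<partial>srw G u) = (\<integral>\<^sup>+\<omega>. ?f k (restrict \<omega> {0..<Suc k}) \<partial>srw G u)"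
      by (intro nn_integral_cong) auto
    also have "\<dots> = (\<integral>\<^sup>+\<omega>. ?f k \<omega> \<partial>srw.C G u 0 (Suc k) (\<lambda>_. undefined))"
      by (intro nn_integral_srw_finite measurable_avoid) auto
    also have "\<dots> = survival G v k u"
      by (simp only: nn_integral_avoid[where g="\<lambda>_. 1"] survival_eq_funpow)
    finally show "(\<integral>\<^sup>+\<omega>. ?f k \<omega> \<partial>srw G u) = survival G v k u" .
  qed
  finally show ?thesis .
qed

text \<open>The first-step equations determine the hitting times once they have a nonnegative
  solution \<open>h\<close> on a finite set closed under neighbours. Partial sums of survival
  probabilities stay below \<open>h\<close>, so their series converges; unrolling the equations
  \<open>m\<close> times leaves a remainder of at most a constant times the \<open>m\<close>-th
  survival probability, which tends to 0.\<close>

lemma hitting_time_eqI: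
  fixes h :: "'a \<Rightarrow> real"
  assumes "finite V"
    and nb: "\<And>x. x \<in> V \<Longrightarrow> neighbors G x \<noteq> {} \<and> neighbors G x \<subseteq> V"
    and h_nonneg: "\<And>x. x \<in> V \<Longrightarrow> 0 \<le> h x" and "h v = 0"
    and h_step: "\<And>x. x \<in> V \<Longrightarrow> x \<noteq> v \<Longrightarrow>
      h x = 1 + (\<Sum>y\<in>neighbors G x. h y) / card (neighbors G x)"
    and "u \<in> V"
  shows "hitting_time G u v = ennreal (h u)"
proof -
  let ?N = "neighbors G"
  \<comment> \<open>A real-valued copy of \<open>survival\<close>, so that sums and limits can be
    handled in the reals.\<close>
  define r where "r = rec_nat (\<lambda>x. if x = v then 0 else 1 :: real)
    (\<lambda>_ r x. if x = v then 0 else (\<Sum>y\<in>?N x. r y) / card (?N x))"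
  have r_0: "r 0 x = (if x = v then 0 else 1)" for x by (simp add: r_def)
  have r_Suc: "r (Suc k) x = (if x = v then 0 else (\<Sum>y\<in>?N x. r k y) / card (?N x))" for k x
    by (simp add: r_def)
  have r_nonneg: "0 \<le> r k x" for k x
    by (induction k arbitrary: x) (auto simp: r_0 r_Suc intro!: divide_nonneg_nonneg sum_nonneg)
  have fin: "finite (?N x)" if "x \<in> V" for x
    using nb[OF that] \<open>finite V\<close> finite_subset by blast
  have pos: "0 < real (card (?N x))" if "x \<in> V" for x
    using nb[OF that] fin[OF that] by (simp add: card_gt_0_iff)
  have survival_r: "survival G v k x = ennreal (r k x)" if "x \<in> V" for k x
    using that
  proof (induction k arbitrary: x)
    case (Suc k)
    have "nb_mean G (survival G v k) x =
        (\<Sum>y\<in>?N x. survival G v k y * ennreal (1 / card (?N x)))"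
      using nb[OF Suc.prems] fin[OF Suc.prems] unfolding nb_mean_def
      by (subst nn_integral_measure_pmf_finite) (auto simp: pmf_of_set intro!: sum.cong)
    also have "\<dots> = (\<Sum>y\<in>?N x. ennreal (r k y * (1 / card (?N x))))"
      using Suc.IH nb[OF Suc.prems] r_nonneg
      by (intro sum.cong) (auto simp: ennreal_mult[symmetric])
    also have "\<dots> = ennreal ((\<Sum>y\<in>?N x. r k y) / card (?N x))"
      using r_nonneg by (simp add: sum_divide_distrib sum_ennreal)
    finally show ?case by (simp add: r_Suc)
  qed (simp add: r_0)
  have partial_Suc: "(\<Sum>k<Suc m. r k x) = 1 + (\<Sum>y\<in>?N x. \<Sum>k<m. r k y) / card (?N x)"
    if "x \<noteq> v" for m x
    using that
    by (simp add: sum.lessThan_Suc_shift r_0 r_Suc sum_divide_distrib del: sum.lessThan_Suc)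
      (rule sum.swap)
  have upper: "(\<Sum>k<m. r k x) \<le> h x" if "x \<in> V" for m x
    using that
  proof (induction m arbitrary: x)
    case (Suc m)
    show ?case
    proof (cases "x = v")
      case True
      have "r k v = 0" for k by (cases k) (simp_all add: r_0 r_Suc)
      then show ?thesis using True \<open>h v = 0\<close> by simp
    next
      case False
      have "(\<Sum>y\<in>?N x. \<Sum>k<m. r k y) \<le> (\<Sum>y\<in>?N x. h y)"
        using Suc nb[OF Suc.prems] by (intro sum_mono) auto
      then show ?thesis
        unfolding partial_Suc[OF False] h_step[OF Suc.prems False]
        using pos[OF Suc.prems] by (simp add: divide_right_mono)
    qed
  qed (simp add: h_nonneg)
  define B where "B = (\<Sum>x\<in>V. h x)"
  have h_le_B: "h x \<le> B" if "x \<in> V" for x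
    unfolding B_def using that h_nonneg \<open>finite V\<close> by (intro member_le_sum) auto
  \<comment> \<open>After \<open>m\<close> unrollings the walk is still running with probability
    \<open>r m x\<close>, and its remaining value of \<open>h\<close> is at most
    \<open>B\<close>.\<close>
  have lower: "h x \<le> (\<Sum>k<m. r k x) + B * r m x" if "x \<in> V" for m x
    using that
  proof (induction m arbitrary: x)
    case 0
    then show ?case using h_le_B \<open>h v = 0\<close> by (simp add: r_0)
  next
    case (Suc m)
    show ?case
    proof (cases "x = v")
      case True
      have "r k v = 0" for k by (cases k) (simp_all add: r_0 r_Suc)
      then show ?thesis using True \<open>h v = 0\<close> by simp
    next
      case False
      have "(\<Sum>y\<in>?N x. h y) \<le> (\<Sum>y\<in>?N x. (\<Sum>k<m. r k y) + B * r m y)"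
        using Suc nb[OF Suc.prems] by (intro sum_mono) auto
      then have "(\<Sum>y\<in>?N x. h y) / card (?N x) \<le>
          (\<Sum>y\<in>?N x. (\<Sum>k<m. r k y) + B * r m y) / card (?N x)"
        by (rule divide_right_mono) simp
      also have "\<dots> = (\<Sum>y\<in>?N x. \<Sum>k<m. r k y) / card (?N x) + B * r (Suc m) x"
        using False by (simp add: r_Suc sum.distrib add_divide_distrib sum_distrib_left[symmetric])
      finally have "(\<Sum>y\<in>?N x. h y) / card (?N x) \<le>
          (\<Sum>y\<in>?N x. \<Sum>k<m. r k y) / card (?N x) + B * r (Suc m) x" .
      then show ?thesis
        unfolding partial_Suc[OF False] h_step[OF Suc.prems False] by simp
    qed
  qed
  have sum_u: "summable (\<lambda>k. r k u)"
    using upper[OF \<open>u \<in> V\<close>] r_nonneg by (intro summableI_nonneg_bounded) auto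
  \<comment> \<open>Summability gives both the limit of the partial sums and the vanishing of the
    remainder.\<close>
  have "(\<lambda>m. (\<Sum>k<m. r k u) + B * r m u) \<longlonglongrightarrow> (\<Sum>k. r k u) + B * 0"
    using sum_u by (intro tendsto_intros summable_LIMSEQ summable_LIMSEQ_zero)
  then have "h u \<le> (\<Sum>k. r k u)"
    using lower[OF \<open>u \<in> V\<close>] by (intro LIMSEQ_le_const) auto
  moreover have "(\<Sum>k. r k u) \<le> h u"
    using upper[OF \<open>u \<in> V\<close>] sum_u by (intro suminf_le_const) auto
  ultimately have "(\<Sum>k. r k u) = h u" by simp
  then show ?thesis
    unfolding hitting_time_eq_suminf_survival survival_r[OF \<open>u \<in> V\<close>]
    using sum_u r_nonneg by (simp add: suminf_ennreal2)
qed

section \<open>Recursive trees\<close>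

text \<open>A rooted tree on \<open>{..<n}\<close> with root \<open>0\<close>, given by its parent
  map. Smaller labels for parents exclude cycles and allow induction along the labels;
  \<open>q\<close> is arbitrary at \<open>0\<close> and from \<open>n\<close> on.\<close>

locale recursive_tree =
  fixes n :: nat and q :: "nat \<Rightarrow> nat"
  assumes n_pos: "0 < n" and parent_less: "0 < i \<Longrightarrow> i < n \<Longrightarrow> q i < i"
begin

text \<open>The vertex set of the subtree hanging from \<open>i\<close>, with \<open>i\<close>
  included. The relation starts at positive labels only, since \<open>q 0\<close> is
  arbitrary.\<close>

definition desc :: "nat \<Rightarrow> nat set" where
  "desc i = {j. j < n \<and> (j, i) \<in> {(k, q k) | k. 0 < k \<and> k < n}\<^sup>*}"

definition children :: "nat \<Rightarrow> nat set" where
  "children i = {k. 0 < k \<and> k < n \<and> q k = i}"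

definition deg :: "nat \<Rightarrow> nat" where
  "deg i = (if i = 0 then card (children i) else Suc (card (children i)))"

text \<open>The expected time to go from \<open>j\<close> to the root, summed over the ancestors of \<open>j\<close>.\<close>

definition root_time :: "nat \<Rightarrow> real" where
  "root_time j = (\<Sum>i | 0 < i \<and> i < n \<and> j \<in> desc i. 2 * real (card (desc i)) - 1)"

text \<open>By \<open>sum_deg_root_time\<close> this is the degree-weighted sum of the expected
  times to the root, hence \<open>2 * (n - 1)\<close> times the stationary hitting time of the
  root.\<close>

definition cost :: real where
  "cost = (\<Sum>i\<in>{0<..<n}. (2 * real (card (desc i)) - 1)\<^sup>2)"

section \<open>Subtrees, their sizes and their degree sums\<close>

lemma finite_desc [simp]: "finite (desc i)"
  unfolding desc_def by simp

lemma finite_children [simp]: "finite (children i)"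
  unfolding children_def by simp

lemma desc_refl: "i < n \<Longrightarrow> i \<in> desc i"
  by (simp add: desc_def)

lemma desc_less: "j \<in> desc i \<Longrightarrow> j < n"
  by (simp add: desc_def)

lemma desc_ge: "j \<in> desc i \<Longrightarrow> i \<le> j"
proof -
  have "i \<le> j" if "(j, i) \<in> {(k, q k) | k. 0 < k \<and> k < n}\<^sup>*"
    using that by induction (auto dest: parent_less)
  then show "j \<in> desc i \<Longrightarrow> i \<le> j" by (simp add: desc_def)
qed

text \<open>Splits the chain of ancestors at its lower end, whereas \<open>desc_eq_children\<close>
  splits it at its upper end.\<close>

lemma desc_step: "j \<in> desc i \<longleftrightarrow> j < n \<and> (j = i \<or> 0 < j \<and> q j \<in> desc i)"
proof
  assume "j \<in> desc i"
  then have "j < n" "(j, i) \<in> {(k, q k) | k. 0 < k \<and> k < n}\<^sup>*" by (auto simp: desc_def)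
  from this(2,1) show "j < n \<and> (j = i \<or> 0 < j \<and> q j \<in> desc i)"
    by (cases rule: converse_rtranclE) (auto simp: desc_def dest: parent_less)
next
  assume "j < n \<and> (j = i \<or> 0 < j \<and> q j \<in> desc i)"
  then show "j \<in> desc i"
    by (auto simp: desc_def intro: converse_rtrancl_into_rtrancl)
qed

lemma desc_eq_children: "i < n \<Longrightarrow> desc i = insert i (\<Union>k\<in>children i. desc k)"
proof (intro equalityI subsetI)
  fix j assume "j \<in> desc i"
  then have "j < n" "(j, i) \<in> {(k, q k) | k. 0 < k \<and> k < n}\<^sup>*" by (auto simp: desc_def)
  from this(2,1) show "j \<in> insert i (\<Union>k\<in>children i. desc k)"
    by (cases rule: rtranclE) (auto simp: desc_def children_def)
next
  fix j assume "i < n" "j \<in> insert i (\<Union>k\<in>children i. desc k)"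
  then show "j \<in> desc i"
    by (auto simp: desc_def children_def intro: rtrancl_into_rtrancl)
qed

text \<open>Replacing a common descendant by its parent moves it up until it meets one of the two
  siblings, and siblings are never below each other.\<close>

lemma children_desc_disjoint:
  assumes "k \<in> children i" "k' \<in> children i" "j \<in> desc k" "j \<in> desc k'"
  shows "k = k'"
  using assms(3,4)
proof (induction j rule: less_induct)
  case (less j)
  \<comment> \<open>If \<open>a\<close> were strictly below its sibling \<open>b\<close>, then their
    parent \<open>i\<close> would be below \<open>b\<close> too, although
    \<open>i < b\<close>.\<close>
  have *: "a = b" if "a \<in> children i" "b \<in> children i" "a \<in> desc b" for a b
    using that desc_step[of a b] desc_ge[of i b] by (auto simp: children_def dest: parent_less)
  show ?case
  proof (cases "j = k \<or> j = k'")
    case True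
    then show ?thesis using * assms(1,2) less.prems by metis
  next
    case False
    then have "0 < j" "j < n" "q j \<in> desc k" "q j \<in> desc k'"
      using less.prems desc_step by blast+
    then show ?thesis using less.IH parent_less by blast
  qed
qed

lemma card_desc:
  assumes "i < n"
  shows "card (desc i) = Suc (\<Sum>k\<in>children i. card (desc k))"
proof -
  have "i \<notin> (\<Union>k\<in>children i. desc k)"
    by (auto simp: children_def dest!: desc_ge parent_less)
  moreover have "card (\<Union>k\<in>children i. desc k) = (\<Sum>k\<in>children i. card (desc k))"
    by (intro card_UN_disjoint) (auto dest: children_desc_disjoint)
  ultimately show ?thesis
    unfolding desc_eq_children[OF assms] by simp
qed

text \<open>A subtree with \<open>s\<close> vertices has \<open>s - 1\<close> inner edges, each
  counted twice, and one edge to the parent of \<open>i\<close>, counted once.\<close>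

lemma sum_deg_desc:
  assumes "0 < i" "i < n"
  shows "(\<Sum>j\<in>desc i. real (deg j)) = 2 * real (card (desc i)) - 1"
proof -
  have "(\<Union>j\<in>desc i. children j) = desc i - {i}"
  proof (intro equalityI subsetI)
    fix k assume "k \<in> (\<Union>j\<in>desc i. children j)"
    then have k: "0 < k" "k < n" "q k \<in> desc i" by (auto simp: children_def)
    then show "k \<in> desc i - {i}"
      using desc_step[of k i] desc_ge[of "q k" i] parent_less[of k] by auto
  next
    fix k assume "k \<in> desc i - {i}"
    then show "k \<in> (\<Union>j\<in>desc i. children j)"
      using desc_step[of k i] by (auto simp: children_def)
  qed
  moreover have "card (\<Union>j\<in>desc i. children j) = (\<Sum>j\<in>desc i. card (children j))"
    by (intro card_UN_disjoint) (auto simp: children_def)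
  ultimately have "(\<Sum>j\<in>desc i. card (children j)) = card (desc i) - 1"
    using desc_refl[OF \<open>i < n\<close>] by simp
  moreover have "0 < card (desc i)"
    using desc_refl[OF \<open>i < n\<close>] by (auto simp: card_gt_0_iff)
  moreover have "(\<Sum>j\<in>desc i. deg j) = (\<Sum>j\<in>desc i. card (children j) + 1)"
    using assms by (intro sum.cong) (auto simp: deg_def dest: desc_ge)
  ultimately have "(\<Sum>j\<in>desc i. deg j) = 2 * card (desc i) - 1"
    by (simp only: sum.distrib) simp
  then have "real (\<Sum>j\<in>desc i. deg j) = 2 * real (card (desc i)) - 1"
    using \<open>0 < card (desc i)\<close> by (simp add: of_nat_diff)
  then show ?thesis by simp
qed

section \<open>Expected time to the root\<close>

lemma root_time_0: "root_time 0 = 0"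
  unfolding root_time_def by (intro sum.neutral) (auto dest: desc_ge)

lemma root_time_nonneg: "0 \<le> root_time j"
  unfolding root_time_def
proof (intro sum_nonneg)
  fix i assume "i \<in> {i. 0 < i \<and> i < n \<and> j \<in> desc i}"
  then have "0 < card (desc i)" by (auto simp: card_gt_0_iff)
  then show "0 \<le> 2 * real (card (desc i)) - 1" by linarith
qed

lemma root_time_parent:
  assumes "0 < j" "j < n"
  shows "root_time j = root_time (q j) + 2 * real (card (desc j)) - 1"
proof -
  have "{i. 0 < i \<and> i < n \<and> j \<in> desc i} = insert j {i. 0 < i \<and> i < n \<and> q j \<in> desc i}"
    using assms desc_step[of j] by auto
  moreover have "j \<notin> {i. 0 < i \<and> i < n \<and> q j \<in> desc i}"
    using assms parent_less[of j] desc_ge[of "q j" j] by auto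
  ultimately show ?thesis
    unfolding root_time_def by simp
qed

text \<open>Compared with \<open>root_time j\<close>, the parent is lower by \<open>2 s - 1\<close>
  and a child with subtree size \<open>t\<close> is higher by \<open>2 t - 1\<close>. As the sizes
  \<open>t\<close> add up to \<open>s - 1\<close>, the differences over all \<open>c + 1\<close>
  neighbours add up to \<open>-(c + 1)\<close>.\<close>

lemma root_time_harmonic:
  assumes "0 < j" "j < n"
  shows "root_time j = 1 + (\<Sum>k\<in>insert (q j) (children j). root_time k) / card (insert (q j) (children j))"
proof -
  have q_notin: "q j \<notin> children j"
    using assms parent_less[of j] parent_less[of "q j"] by (auto simp: children_def)
  let ?c = "real (card (children j))"
  have "(\<Sum>k\<in>children j. root_time k) = (\<Sum>k\<in>children j. root_time j - 1 + 2 * real (card (desc k)))"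
    by (intro sum.cong) (auto simp: children_def root_time_parent)
  also have "\<dots> = ?c * (root_time j - 1) + 2 * (real (card (desc j)) - 1)"
    using card_desc[OF \<open>j < n\<close>] by (simp add: sum.distrib sum_distrib_left[symmetric])
  moreover have "root_time (q j) = root_time j - 2 * real (card (desc j)) + 1"
    using root_time_parent[OF assms] by simp
  ultimately have "(\<Sum>k\<in>insert (q j) (children j). root_time k) = (1 + ?c) * (root_time j - 1)"
    using q_notin by (simp add: algebra_simps)
  moreover have "real (card (insert (q j) (children j))) = 1 + ?c"
    using q_notin by simp
  moreover have "1 + ?c \<noteq> 0" by linarith
  ultimately show ?thesis by simp
qed

text \<open>After the exchange of sums, \<open>2 s - 1\<close> occurs twice: as the expected time
  across the edge above \<open>i\<close> and, by \<open>sum_deg_desc\<close>, as the degree sum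
  below it. This produces the squares.\<close>

lemma sum_deg_root_time: "(\<Sum>j<n. real (deg j) * root_time j) = cost"
proof -
  let ?s = "\<lambda>i. 2 * real (card (desc i)) - 1"
  have "(\<Sum>j<n. real (deg j) * root_time j) =
      (\<Sum>j<n. \<Sum>i | i \<in> {0<..<n} \<and> j \<in> desc i. real (deg j) * ?s i)"
    unfolding root_time_def by (intro sum.cong) (auto simp: sum_distrib_left intro!: sum.cong)
  also have "\<dots> = (\<Sum>i\<in>{0<..<n}. \<Sum>j | j \<in> {..<n} \<and> j \<in> desc i. real (deg j) * ?s i)"
    by (rule sum.swap_restrict) auto
  also have "\<dots> = (\<Sum>i\<in>{0<..<n}. \<Sum>j\<in>desc i. real (deg j) * ?s i)"
    by (intro sum.cong) (auto dest: desc_less)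
  also have "\<dots> = cost"
    unfolding cost_def by (intro sum.cong)
      (simp_all add: sum_distrib_right[symmetric] sum_deg_desc power2_eq_square)
  finally show ?thesis .
qed

section \<open>Extremal values of the cost\<close>

lemma card_desc_le: "i < n \<Longrightarrow> card (desc i) \<le> n - i"
proof -
  have "desc i \<subseteq> {i..<n}" by (auto dest: desc_ge desc_less)
  then show ?thesis by (metis card_atLeastLessThan card_mono finite_atLeastLessThan)
qed

lemma card_desc_pos: "i < n \<Longrightarrow> 0 < card (desc i)"
  using desc_refl by (auto simp: card_gt_0_iff)

text \<open>Up to order these are the first \<open>n - 1\<close> odd squares; reflecting the index
  makes induction on \<open>n\<close> possible.\<close>

lemma sum_odd_squares:
  "(\<Sum>i\<in>{0<..<n}. (2 * real (n - i) - 1)\<^sup>2) = (real n - 1) * (4 * (real n - 1)\<^sup>2 - 1) / 3"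
proof -
  have "(\<Sum>i\<in>{0<..<n}. (2 * real (n - i) - 1)\<^sup>2) = (\<Sum>k\<in>{0<..<n}. (2 * real k - 1)\<^sup>2)"
    by (rule sum.reindex_bij_witness[of _ "\<lambda>k. n - k" "\<lambda>k. n - k"]) auto
  also have "\<dots> = (real n - 1) * (4 * (real n - 1)\<^sup>2 - 1) / 3"
    using n_pos
  proof (induction n rule: nat_induct_non_zero)
    case (Suc m)
    have "{0<..<Suc m} = insert m {0<..<m}" using Suc by auto
    then show ?case using Suc by (simp add: field_simps power2_eq_square)
  qed simp
  finally show ?thesis .
qed

text \<open>Squaring preserves the order because subtree sizes are positive, which keeps
  \<open>2 s - 1\<close> nonnegative.\<close>

lemma cost_term_mono:
  assumes "i < n" "card (desc i) \<le> m"
  shows "(2 * real (card (desc i)) - 1)\<^sup>2 \<le> (2 * real m - 1)\<^sup>2"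
  using assms card_desc_pos[of i] by (intro power_mono) auto

lemma cost_le_path: "cost \<le> (real n - 1) * (4 * (real n - 1)\<^sup>2 - 1) / 3"
  unfolding cost_def sum_odd_squares[symmetric]
  by (intro sum_mono cost_term_mono card_desc_le) auto

text \<open>The bound holds term by term, so equality of the sums makes every subtree as large as
  possible, namely \<open>{i..<n}\<close>, and these subtrees determine the parents.\<close>

lemma cost_path_iff:
  "cost = (real n - 1) * (4 * (real n - 1)\<^sup>2 - 1) / 3 \<longleftrightarrow> (\<forall>i. 0 < i \<and> i < n \<longrightarrow> q i = i - 1)"
proof
  assume eq: "cost = (real n - 1) * (4 * (real n - 1)\<^sup>2 - 1) / 3"
  have full: "desc i = {i..<n}" if "0 < i" "i < n" for i
  proof -
    have "card (desc i) = n - i"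
    proof (rule ccontr)
      assume "card (desc i) \<noteq> n - i"
      then have "card (desc i) < n - i" using card_desc_le[OF \<open>i < n\<close>] by simp
      then have "(2 * real (card (desc i)) - 1)\<^sup>2 < (2 * real (n - i) - 1)\<^sup>2"
        using card_desc_pos[OF \<open>i < n\<close>] by (intro power_strict_mono) auto
      then have "cost < (\<Sum>i\<in>{0<..<n}. (2 * real (n - i) - 1)\<^sup>2)"
        unfolding cost_def using that
        by (intro sum_strict_mono_ex1 ballI bexI[of _ i] cost_term_mono card_desc_le) simp_all
      then show False using eq sum_odd_squares by (metis less_irrefl)
    qed
    moreover have "desc i \<subseteq> {i..<n}" by (auto dest: desc_ge desc_less)
    ultimately show ?thesis by (intro card_subset_eq) auto
  qed
  show "\<forall>i. 0 < i \<and> i < n \<longrightarrow> q i = i - 1"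
  proof (intro allI impI)
    fix i assume i: "0 < i \<and> i < n"
    show "q i = i - 1"
    proof (cases "i = 1")
      case False
      \<comment> \<open>As \<open>i\<close> lies below \<open>i - 1\<close>, so does its parent, and
        \<open>q i < i\<close> leaves only \<open>i - 1\<close>. The label \<open>1\<close> is
        treated apart because \<open>full\<close> covers only positive labels.\<close>
      then have "i \<in> desc (i - 1)" using i by (subst full) auto
      then have "q i \<in> desc (i - 1)" using desc_step[of i "i - 1"] i by auto
      then show ?thesis using desc_ge[of "q i" "i - 1"] parent_less[of i] i by auto
    qed (use i parent_less in auto)
  qed
next
  assume path: "\<forall>i. 0 < i \<and> i < n \<longrightarrow> q i = i - 1"
  have "j \<in> desc i" if "i \<le> j" "j < n" for i j
    using that
  proof (induction j)
    case (Suc j)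
    then show ?case using path desc_step[of "Suc j" i] by (cases "i = Suc j") auto
  qed (simp add: desc_refl)
  then have "desc i = {i..<n}" for i by (auto dest: desc_ge desc_less)
  then show "cost = (real n - 1) * (4 * (real n - 1)\<^sup>2 - 1) / 3"
    unfolding cost_def sum_odd_squares[symmetric] by simp
qed

text \<open>Below the centre all subtrees are singletons. The value serves to show that the centre
  of a star is never a costlier target than a leaf.\<close>

lemma cost_star_center:
  assumes "\<And>i. 0 < i \<Longrightarrow> i < n \<Longrightarrow> q i = 0"
  shows "cost = real n - 1"
proof -
  have "desc i = {i}" if "0 < i" "i < n" for i
  proof -
    have "j = i" if "j \<in> desc i" for j
      using that desc_step[of j i] desc_ge[of "q j" i] assms[of j] \<open>0 < i\<close> by auto
    then show ?thesis using desc_refl[OF \<open>i < n\<close>] by auto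
  qed
  then show ?thesis
    unfolding cost_def using n_pos by (simp add: of_nat_diff)
qed

text \<open>The hypothesis says that the root is a leaf.\<close>

lemma
  assumes "2 \<le> n" and leaf: "\<And>i. 1 < i \<Longrightarrow> i < n \<Longrightarrow> q i \<noteq> 0"
  shows cost_ge_star: "(2 * real n - 3)\<^sup>2 + (real n - 2) \<le> cost" (is ?ge)
    and cost_star_iff: "cost = (2 * real n - 3)\<^sup>2 + (real n - 2) \<longleftrightarrow>
      (\<forall>i. 1 < i \<and> i < n \<longrightarrow> q i = 1)" (is ?iff)
proof -
  \<comment> \<open>No label above \<open>1\<close> has the root as parent, so every chain of
    ancestors enters the root through \<open>1\<close>.\<close>
  have "j \<in> desc 1" if "0 < j" "j < n" for j
    using that
  proof (induction j rule: less_induct)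
    case (less j)
    then show ?case
      using leaf[of j] parent_less[of j] desc_step[of j 1] by (cases "j = 1") auto
  qed
  then have "desc 1 = {0<..<n}" using desc_ge[of _ 1] desc_less[of _ 1] by fastforce
  moreover have "{0<..<n} = insert 1 {1<..<n}" using \<open>2 \<le> n\<close> by auto
  \<comment> \<open>The subtree of \<open>1\<close> has \<open>n - 1\<close> vertices, so its term
    is the square of \<open>2 * (n - 1) - 1 = 2 * n - 3\<close>.\<close>
  ultimately have split: "cost = (2 * real n - 3)\<^sup>2 +
      (\<Sum>i\<in>{1<..<n}. (2 * real (card (desc i)) - 1)\<^sup>2)"
    using \<open>2 \<le> n\<close> unfolding cost_def by (simp add: of_nat_diff algebra_simps)
  have ones: "(\<Sum>i\<in>{1<..<n}. 1) = real n - 2" using \<open>2 \<le> n\<close> by (simp add: of_nat_diff)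
  have ge1: "1 \<le> (2 * real (card (desc i)) - 1)\<^sup>2" if "i < n" for i
    using card_desc_pos[OF that] by (intro one_le_power) linarith
  then have "(\<Sum>i\<in>{1<..<n}. 1) \<le> (\<Sum>i\<in>{1<..<n}. (2 * real (card (desc i)) - 1)\<^sup>2)"
    by (intro sum_mono) auto
  then show ?ge using split ones by simp
  show ?iff
  proof
    assume eq: "cost = (2 * real n - 3)\<^sup>2 + (real n - 2)"
    have single: "card (desc i) = 1" if "1 < i" "i < n" for i
    proof (rule ccontr)
      assume "card (desc i) \<noteq> 1"
      then have "1 < 2 * real (card (desc i)) - 1" using card_desc_pos[OF \<open>i < n\<close>] by linarith
      then have "1 < (2 * real (card (desc i)) - 1)\<^sup>2" by (simp add: one_less_power)
      then have "(\<Sum>i\<in>{1<..<n}. 1) < (\<Sum>i\<in>{1<..<n}. (2 * real (card (desc i)) - 1)\<^sup>2)"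
        using that ge1 by (intro sum_strict_mono_ex1) auto
      then show False using eq split ones by simp
    qed
    show "\<forall>i. 1 < i \<and> i < n \<longrightarrow> q i = 1"
    proof (intro allI impI, rule ccontr)
      fix i assume i: "1 < i \<and> i < n" and "q i \<noteq> 1"
      \<comment> \<open>A parent other than \<open>1\<close> would itself exceed \<open>1\<close>
        and have at least two descendants, itself and \<open>i\<close>.\<close>
      then have qi: "1 < q i" "q i < n" "q i < i"
        using leaf[of i] parent_less[of i] by auto
      then have "{i, q i} \<subseteq> desc (q i)"
        using i desc_step[of i "q i"] desc_refl[of "q i"] by auto
      then have "card {i, q i} \<le> card (desc (q i))" by (intro card_mono) auto
      then show False using single[OF qi(1,2)] qi(3) by simp
    qed
  next
    assume star: "\<forall>i. 1 < i \<and> i < n \<longrightarrow> q i = 1"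
    have "desc i = {i}" if "1 < i" "i < n" for i
    proof -
      have "j = i" if "j \<in> desc i" for j
      proof (rule ccontr)
        assume "j \<noteq> i"
        then have "q j \<in> desc i" "0 < j" "j < n" using that desc_step[of j i] by auto
        then have "i \<le> q j" "j \<noteq> 1" using \<open>1 < i\<close> desc_ge[of "q j" i] parent_less[of j] by auto
        then show False using star \<open>0 < j\<close> \<open>j < n\<close> \<open>1 < i\<close> by auto
      qed
      then show ?thesis using desc_refl[OF \<open>i < n\<close>] by auto
    qed
    then show "cost = (2 * real n - 3)\<^sup>2 + (real n - 2)"
      using split ones by simp
  qed
qed

end

section \<open>Labelled trees\<close>

text \<open>Library connectivity refers to the symmetric closure and to chains inside the vertex
  set; arcs of a pair graph are symmetric and end in vertices, so plain reachability
  suffices.\<close>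

lemma pair_graph_connected_iff:
  assumes "pair_graph G"
  shows "Digraph_Component.connected (with_proj G) \<longleftrightarrow>
    pverts G \<noteq> {} \<and> (\<forall>u\<in>pverts G. \<forall>v\<in>pverts G. (u, v) \<in> (parcs G)\<^sup>*)"
proof -
  interpret pair_graph G by (fact assms)
  have "(parcs G)\<^sup>s = parcs G"
    by (auto simp: symcl_def intro: arcs_symmetric)
  moreover have "(u, v) \<in> rtrancl_on (pverts G) (parcs G) \<longleftrightarrow> (u, v) \<in> (parcs G)\<^sup>*"
    if "u \<in> pverts G" "v \<in> pverts G" for u v
    using that rtrancl_consistent_rtrancl_on[of u v "parcs G" "pverts G"]
      rtrancl_on_rtranclI in_arcsD2 by metis
  ultimately show ?thesis
    by (auto simp: connected_conv)
qed

lemma pcas_consecutive: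
  "pcas u p v \<Longrightarrow> Suc i < length p \<Longrightarrow> fst (p ! Suc i) = snd (p ! i)"
proof (induction p arbitrary: u i)
  case (Cons a p)
  then show ?case
    by (cases i; cases p) auto
qed simp

lemma pcas_ends:
  "pcas u p v \<Longrightarrow> p \<noteq> [] \<Longrightarrow> fst (hd p) = u \<and> snd (last p) = v"
  by (induction u p v rule: pcas.induct) (auto split: if_splits)

text \<open>Reads the vertices off the tails of an arbitrary arc list; for actual walks
  \<open>pcas_pawalk_verts\<close> reads them off the heads.\<close>

lemma pawalk_verts_conv: "pawalk_verts u p = (if p = [] then [u] else map fst p @ [snd (last p)])"
  by (induction p arbitrary: u) auto

lemma pcas_pawalk_verts: "pcas u p v \<Longrightarrow> pawalk_verts u p = u # map snd p"
  by (induction u p v rule: pcas.induct) auto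

text \<open>
  In an acyclic graph an arc is the only path between its ends, hence lies in every connected
  spanning subgraph.
\<close>

lemma tree_arc_in_connected_subgraph:
  assumes "is_tree G" "pair_wf_digraph H" "parcs H \<subseteq> parcs G" "pverts H = pverts G"
    and "(x, y) \<in> parcs G" "(x, y) \<in> (parcs H)\<^sup>*"
  shows "(x, y) \<in> parcs H"
proof (rule ccontr)
  assume notin: "(x, y) \<notin> parcs H"
  interpret G: pair_graph G using assms(1) by (simp add: is_tree_def)
  interpret H: pair_wf_digraph H by (fact assms(2))
  have "x \<in> pverts H" "x \<noteq> y" "y \<in> pverts H"
    using assms(4,5) G.in_arcsD1 G.in_arcsD2 G.no_loops' by auto
  then have "(x, y) \<in> rtrancl_on (pverts H) (parcs H)"
    using rtrancl_consistent_rtrancl_on[of x y "parcs H" "pverts H"] assms(6) H.in_arcsD2 by metis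
  then have "reachable (with_proj H) x y" by (simp add: reachable_def)
  then obtain p where p: "H.apath x p y" by (auto simp: H.reachable_apath)
  then have walk: "set p \<subseteq> parcs H" "pcas x p y" "distinct (pawalk_verts x p)"
    by (auto simp: H.apath_def H.awalk_def)
  have "p \<noteq> []" using walk(2) \<open>x \<noteq> y\<close> by auto
  \<comment> \<open>A path of a single arc would be \<open>(x, y)\<close> itself, which
    \<open>H\<close> does not contain.\<close>
  moreover have "length p \<noteq> 1"
  proof
    assume "length p = 1"
    then obtain a where "p = [a]" by (auto simp: length_Suc_conv)
    then show False using walk notin by (cases a) auto
  qed
  ultimately have "2 \<le> length p" by (cases p; cases "tl p") auto
  \<comment> \<open>Closing the path with \<open>(y, x)\<close> yields a cycle of length at least
    3.\<close>
  have "G.awalk x (p @ [(y, x)]) x"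
    unfolding G.awalk_def using walk assms(3,4,5) \<open>x \<in> pverts H\<close> \<open>p \<noteq> []\<close>
    by (auto simp: G.arcs_symmetric H.cas_append_iff pawalk_verts_conv dest: pcas_ends)
  moreover have "pawalk_verts x (p @ [(y, x)]) = pawalk_verts x p @ [x]"
    using pcas_ends[OF walk(2) \<open>p \<noteq> []\<close>] \<open>p \<noteq> []\<close> by (simp add: pawalk_verts_conv)
  moreover have "distinct (tl (pawalk_verts x p @ [x]))"
    using walk(3) unfolding pcas_pawalk_verts[OF walk(2)] by simp
  ultimately have "G.cycle (p @ [(y, x)])"
    unfolding G.cycle_def by (intro exI[of _ x]) simp
  then show False
    using assms(1) \<open>2 \<le> length p\<close> unfolding is_tree_def by (metis length_append_singleton not_less_eq_eq numeral_2_eq_2 numeral_3_eq_3)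
qed

text \<open>Transports a recursive tree to arbitrary vertices. The target of the walk is always
  \<open>e 0\<close>, so another target means another labelling of the same graph.\<close>

locale labelled_tree = recursive_tree n q for n q +
  fixes G :: "'a pair_pre_digraph" and e :: "nat \<Rightarrow> 'a"
  assumes bij: "bij_betw e {..<n} (pverts G)"
    and arcs: "parcs G = (\<Union>i\<in>{0<..<n}. {(e i, e (q i)), (e (q i), e i)})"
begin

section \<open>Labelled trees are trees\<close>

lemma e_in: "i < n \<Longrightarrow> e i \<in> pverts G"
  using bij by (auto simp: bij_betw_def)

lemma e_eq_iff: "i < n \<Longrightarrow> j < n \<Longrightarrow> e i = e j \<longleftrightarrow> i = j"
  using bij by (auto simp: bij_betw_def inj_on_eq_iff)

lemma pverts_eq: "pverts G = e ` {..<n}"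
  using bij by (simp add: bij_betw_def)

lemma parent_lt: "0 < i \<Longrightarrow> i < n \<Longrightarrow> q i < n"
  using parent_less by (meson less_trans)

lemma arc_iff:
  assumes "i < n" "j < n"
  shows "(e i, e j) \<in> parcs G \<longleftrightarrow> 0 < i \<and> j = q i \<or> 0 < j \<and> i = q j"
proof
  assume "(e i, e j) \<in> parcs G"
  then obtain k where "k \<in> {0<..<n}" "e i = e k \<and> e j = e (q k) \<or> e i = e (q k) \<and> e j = e k"
    unfolding arcs by auto
  then show "0 < i \<and> j = q i \<or> 0 < j \<and> i = q j"
    using assms parent_lt by (auto simp: e_eq_iff)
qed (use assms in \<open>auto simp: arcs\<close>)

lemma parcsE:
  assumes "(x, y) \<in> parcs G"
  obtains i where "0 < i" "i < n" "x = e i \<and> y = e (q i) \<or> x = e (q i) \<and> y = e i"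
  using assms unfolding arcs by auto

lemma pair_graph_G: "pair_graph G"
proof -
  have "finite (pverts G)" unfolding pverts_eq by simp
  moreover have "finite (parcs G)" unfolding arcs by simp
  moreover have "fst a \<in> pverts G" "snd a \<in> pverts G" "fst a \<noteq> snd a" "prod.swap a \<in> parcs G"
    if "a \<in> parcs G" for a
  proof -
    obtain x y where a: "a = (x, y)" by (cases a)
    obtain i where i: "0 < i" "i < n" "x = e i \<and> y = e (q i) \<or> x = e (q i) \<and> y = e i"
      using \<open>a \<in> parcs G\<close> unfolding a by (rule parcsE)
    show "fst a \<in> pverts G" "snd a \<in> pverts G" "fst a \<noteq> snd a"
      using i parent_lt[of i] parent_less[of i] e_in unfolding a by (auto simp: e_eq_iff)
    show "prod.swap a \<in> parcs G"
      using i unfolding a arcs by auto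
  qed
  ultimately show ?thesis
    by unfold_locales (auto simp: symmetric_def intro!: symI)
qed

lemma root_connected: "i < n \<Longrightarrow> (e i, e 0) \<in> (parcs G)\<^sup>*"
proof (induction i rule: less_induct)
  case (less i)
  show ?case
  proof (cases "i = 0")
    case False
    then have "(e i, e (q i)) \<in> parcs G" using less.prems unfolding arcs by auto
    moreover have "(e (q i), e 0) \<in> (parcs G)\<^sup>*"
      using less False parent_less parent_lt by auto
    ultimately show ?thesis by (rule converse_rtrancl_into_rtrancl)
  qed simp
qed

lemma connected_G:
  assumes "x \<in> pverts G" "y \<in> pverts G"
  shows "(x, y) \<in> (parcs G)\<^sup>*"
proof -
  interpret pair_graph G by (fact pair_graph_G)
  have "sym ((parcs G)\<^sup>*)"
    by (rule sym_rtrancl, rule symI, rule arcs_symmetric)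
  moreover have "(y, e 0) \<in> (parcs G)\<^sup>*" "(x, e 0) \<in> (parcs G)\<^sup>*"
    using assms root_connected unfolding pverts_eq by blast+
  ultimately show ?thesis by (blast intro: rtrancl_trans dest: symD)
qed

text \<open>The vertex of largest label on a cycle would have its parent as both of its neighbours.\<close>

lemma no_long_cycle:
  assumes "pre_digraph.cycle (with_proj G) p"
  shows "length p < 3"
proof (rule ccontr)
  assume "\<not> length p < 3"
  then have len: "3 \<le> length p" by simp
  interpret pair_graph G by (fact pair_graph_G)
  obtain u where u: "awalk u p u" "distinct (tl (awalk_verts u p))" "p \<noteq> []"
    using assms unfolding cycle_def by blast
  have walk: "set p \<subseteq> parcs G" "pcas u p u" using u(1) by (auto simp: awalk_def)
  define L where "L = length p"
  \<comment> \<open>Vertices of the cycle are indexed by the heads of its arcs; these form the tail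
    of the vertex list and are therefore distinct.\<close>
  define x where "x i = snd (p ! i)" for i
  have inj: "i = j" if "x i = x j" "i < L" "j < L" for i j
    using u(2) that unfolding pcas_pawalk_verts[OF walk(2)]
    by (auto simp: distinct_conv_nth x_def L_def)
  \<comment> \<open>Cyclic predecessor and successor of a position; they differ because the length
    is at least 3.\<close>
  define before where "before i = (if i = 0 then L - 1 else i - 1)" for i
  define after where "after i = (if i = L - 1 then 0 else Suc i)" for i
  have step: "(x (before i), x i) \<in> parcs G" if "i < L" for i
  proof -
    have "fst (p ! i) = x (before i)"
      using pcas_consecutive[OF walk(2), of "i - 1"] pcas_ends[OF walk(2) u(3)] that u(3)
      by (cases i) (auto simp: x_def before_def L_def last_conv_nth hd_conv_nth)
    moreover have "p ! i \<in> parcs G" using walk(1) that by (auto simp: L_def)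
    ultimately show ?thesis unfolding x_def by (metis prod.collapse)
  qed
  have cyc: "before i < L" "after i < L" "before (after i) = i" "before i \<noteq> after i" if "i < L" for i
    using that len by (auto simp: before_def after_def L_def)
  define lab where "lab y = the_inv_into {..<n} e y" for y
  have lab: "lab (e i) = i" if "i < n" for i
    using that bij by (auto simp: lab_def bij_betw_def the_inv_into_f_f)
  \<comment> \<open>Every neighbour of a vertex is its parent or carries a larger label.\<close>
  have parent: "y = e (q (lab z)) \<or> lab z < lab y" if yz: "(y, z) \<in> parcs G" for y z
  proof -
    obtain i where i: "0 < i" "i < n" "y = e i \<and> z = e (q i) \<or> y = e (q i) \<and> z = e i"
      using yz by (rule parcsE)
    then show ?thesis using lab parent_less[of i] parent_lt[of i] by auto
  qed
  have "finite ((\<lambda>i. lab (x i)) ` {..<L})" "(\<lambda>i. lab (x i)) ` {..<L} \<noteq> {}"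
    using len by (auto simp: L_def lessThan_empty_iff)
  \<comment> \<open>At the position \<open>m\<close> of the largest label neither cycle neighbour
    can have a larger one, so both are the parent.\<close>
  then obtain m where m: "m < L" "\<And>i. i < L \<Longrightarrow> lab (x i) \<le> lab (x m)"
    using Max_in[of "(\<lambda>i. lab (x i)) ` {..<L}"] Max_ge[of "(\<lambda>i. lab (x i)) ` {..<L}"]
    by (smt (verit) imageE imageI lessThan_iff)
  have "x (before m) = e (q (lab (x m)))"
    using parent[OF step[OF m(1)]] m(2)[OF cyc(1)[OF m(1)]] by simp
  moreover have "(x (after m), x m) \<in> parcs G"
    using step[OF cyc(2)[OF m(1)]] cyc(3)[OF m(1)] by (auto intro: arcs_symmetric)
  then have "x (after m) = e (q (lab (x m)))"
    using parent m(2)[OF cyc(2)[OF m(1)]] by force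
  ultimately show False
    using inj cyc(1,2,4)[OF m(1)] by metis
qed

lemma is_tree_G: "is_tree G"
  unfolding is_tree_def pair_graph_connected_iff[OF pair_graph_G]
  using pair_graph_G connected_G no_long_cycle e_in[OF n_pos] by force

section \<open>The walk on a labelled tree\<close>

lemma neighbors_e:
  assumes "i < n"
  shows "neighbors G (e i) = e ` (if i = 0 then children 0 else insert (q i) (children i))"
proof -
  have "neighbors G (e i) = e ` {j. j < n \<and> (e i, e j) \<in> parcs G}"
    unfolding neighbors_def using pair_wf_digraph.in_arcsD2[of G] pair_graph_G
    by (auto simp: pverts_eq pair_graph_def pair_digraph_def pair_fin_digraph_def)
  also have "{j. j < n \<and> (e i, e j) \<in> parcs G} =
      (if i = 0 then children 0 else insert (q i) (children i))"
    using assms arc_iff parent_lt by (auto simp: children_def)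
  finally show ?thesis .
qed

lemma sum_neighbors_e:
  assumes "i < n"
  shows "sum f (neighbors G (e i)) =
    (\<Sum>j\<in>(if i = 0 then children 0 else insert (q i) (children i)). f (e j))"
proof -
  have "inj_on e {..<n}" using bij by (simp add: bij_betw_def)
  then have "inj_on e (if i = 0 then children 0 else insert (q i) (children i))"
    by (rule inj_on_subset) (use assms parent_lt in \<open>auto simp: children_def\<close>)
  then show ?thesis
    unfolding neighbors_e[OF assms] by (simp add: sum.reindex del: if_image_distrib)
qed

lemma card_neighbors_e:
  assumes "i < n"
  shows "card (neighbors G (e i)) = deg i"
proof -
  have "q i \<notin> children i" if "0 < i"
    using that assms parent_less[of i] parent_less[of "q i"] by (auto simp: children_def)
  then show ?thesis
    using sum_neighbors_e[OF assms, of "\<lambda>_. 1 :: nat"] by (auto simp: deg_def)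
qed

lemma neighbors_nonempty:
  assumes "2 \<le> n" "x \<in> pverts G"
  shows "neighbors G x \<noteq> {} \<and> neighbors G x \<subseteq> pverts G"
proof -
  obtain i where i: "x = e i" "i < n" using assms(2) unfolding pverts_eq by auto
  have "1 \<in> children 0" using assms(1) parent_less[of 1] by (auto simp: children_def)
  then show ?thesis
    unfolding i(1) neighbors_e[OF i(2)]
    using i(2) parent_lt e_in by (auto simp: children_def)
qed

text \<open>Carried over along the inverse of \<open>e\<close>, \<open>root_time\<close> solves the
  first-step equations, by \<open>root_time_harmonic\<close>.\<close>

lemma hitting_time_root:
  assumes "2 \<le> n" "j < n"
  shows "hitting_time G (e j) (e 0) = ennreal (root_time j)"
proof -
  define h where "h x = root_time (the_inv_into {..<n} e x)" for x
  have h: "h (e i) = root_time i" if "i < n" for i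
    using that bij by (auto simp: h_def bij_betw_def the_inv_into_f_f)
  have "hitting_time G (e j) (e 0) = ennreal (h (e j))"
  proof (rule hitting_time_eqI[where V="pverts G"])
    show "finite (pverts G)" unfolding pverts_eq by simp
    show "0 \<le> h x" for x by (simp add: h_def root_time_nonneg)
    show "h (e 0) = 0" using n_pos by (simp add: h root_time_0)
    show "neighbors G x \<noteq> {} \<and> neighbors G x \<subseteq> pverts G" if "x \<in> pverts G" for x
      using neighbors_nonempty assms(1) that by blast
    show "h x = 1 + (\<Sum>y\<in>neighbors G x. h y) / card (neighbors G x)"
      if x: "x \<in> pverts G" "x \<noteq> e 0" for x
    proof -
      obtain i where "x = e i" "i < n"
        using x unfolding pverts_eq by auto
      moreover from this have "0 < i" using x(2) by (cases i) auto
      ultimately have i: "x = e i" "0 < i" "i < n" by auto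
      have "(\<Sum>y\<in>neighbors G (e i). h y) = (\<Sum>j\<in>insert (q i) (children i). root_time j)"
        unfolding sum_neighbors_e[OF i(3)] using i parent_lt
        by (auto simp: h children_def intro!: sum.cong)
      moreover have "card (neighbors G (e i)) = card (insert (q i) (children i))"
        using sum_neighbors_e[OF i(3), of "\<lambda>_. 1 :: nat"] i(2) by simp
      ultimately show ?thesis
        unfolding i(1) h[OF i(3)] using root_time_harmonic[OF i(2,3)] by simp
    qed
  qed (use assms e_in in auto)
  then show ?thesis using h assms by simp
qed

text \<open>Arcs towards the parent lower the label and reversed arcs raise it, so the two
  orientations are disjoint.\<close>

lemma card_parcs: "card (parcs G) = 2 * (n - 1)"
proof -
  have "inj_on (\<lambda>i. (e i, e (q i))) {0<..<n}" "inj_on (\<lambda>i. (e (q i), e i)) {0<..<n}"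
    by (auto intro!: inj_onI simp: e_eq_iff)
  moreover have "(\<lambda>i. (e i, e (q i))) ` {0<..<n} \<inter> (\<lambda>i. (e (q i), e i)) ` {0<..<n} = {}"
    using parent_lt parent_less by (auto simp: e_eq_iff) (metis less_asym)
  moreover have "parcs G = (\<lambda>i. (e i, e (q i))) ` {0<..<n} \<union> (\<lambda>i. (e (q i), e i)) ` {0<..<n}"
    unfolding arcs by auto
  ultimately show ?thesis
    by (simp add: card_Un_disjoint card_image)
qed

lemma stationary_e:
  assumes "i < n"
  shows "stationary G (e i) = real (deg i) / (2 * (real n - 1))"
proof -
  have "out_arcs (with_proj G) (e i) = (\<lambda>y. (e i, y)) ` neighbors G (e i)"
    by (auto simp: out_arcs_def neighbors_def)
  then have "out_degree (with_proj G) (e i) = deg i"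
    using card_neighbors_e[OF assms] by (simp add: out_degree_def card_image inj_on_def)
  then show ?thesis
    using n_pos by (simp add: stationary_def card_parcs of_nat_diff)
qed

lemma stationary_hitting_time_root:
  assumes "2 \<le> n"
  shows "stationary_hitting_time G (e 0) = ennreal (cost / (2 * (real n - 1)))"
proof -
  have "stationary_hitting_time G (e 0) =
      (\<Sum>i<n. ennreal (stationary G (e i)) * hitting_time G (e i) (e 0))"
    unfolding stationary_hitting_time_def by (rule sum.reindex_bij_betw[OF bij, symmetric])
  also have "\<dots> = (\<Sum>i<n. ennreal (real (deg i) * root_time i / (2 * (real n - 1))))"
    using assms by (intro sum.cong)
      (auto simp: stationary_e hitting_time_root ennreal_mult[symmetric] root_time_nonneg)
  also have "\<dots> = ennreal (\<Sum>i<n. real (deg i) * root_time i / (2 * (real n - 1)))"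
    using assms by (intro sum_ennreal) (auto simp: root_time_nonneg)
  finally show ?thesis
    by (simp add: sum_divide_distrib[symmetric] sum_deg_root_time)
qed

end

section \<open>Labelling a given tree from a chosen root\<close>

lemma rtrancl_leaves_set:
  assumes "(x, y) \<in> R\<^sup>*" "x \<in> S" "y \<notin> S"
  obtains a b where "(a, b) \<in> R" "a \<in> S" "b \<notin> S"
  using assms by (induction rule: rtrancl_induct) auto

text \<open>The labelling lists the vertices in the order in which a search from \<open>w\<close> finds them.\<close>

lemma ex_labelled_tree:
  assumes "is_tree G" "w \<in> pverts G"
  shows "\<exists>e q. labelled_tree (card (pverts G)) q G e \<and> e 0 = w"
proof -
  interpret pair_graph G using assms(1) by (simp add: is_tree_def)
  define n where "n = card (pverts G)"
  have conn: "(u, v) \<in> (parcs G)\<^sup>*" if "u \<in> pverts G" "v \<in> pverts G" for u v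
    using assms(1) that pair_graph_connected_iff[OF pair_graph] by (auto simp: is_tree_def)
  have "\<exists>e q. e 0 = w \<and> inj_on e {..<k} \<and> e ` {..<k} \<subseteq> pverts G \<and>
      (\<forall>i\<in>{0<..<k}. q i < i \<and> (e i, e (q i)) \<in> parcs G)" if "1 \<le> k" "k \<le> n" for k
    using that
  proof (induction k rule: nat_induct_at_least)
    case base
    then show ?case using assms(2) by (intro exI[of _ "\<lambda>_. w"]) (auto simp: inj_on_def)
  next
    case (Suc k)
    then have "k \<le> n" by simp
    from Suc.IH[OF this] obtain e q where e: "e 0 = w" "inj_on e {..<k}" "e ` {..<k} \<subseteq> pverts G"
      and q: "\<And>i. i \<in> {0<..<k} \<Longrightarrow> q i < i \<and> (e i, e (q i)) \<in> parcs G"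
      by blast
    have "card (e ` {..<k}) < n" using Suc.prems e(2) by (simp add: card_image)
    then have "e ` {..<k} \<noteq> pverts G" unfolding n_def by auto
    then obtain v where v: "v \<in> pverts G" "v \<notin> e ` {..<k}" using e(3) by blast
    have "w \<in> e ` {..<k}" using Suc.hyps e(1) by force
    \<comment> \<open>A chain of arcs from \<open>w\<close> to the unlabelled vertex
      \<open>v\<close> leaves the labelled set somewhere. The outer end \<open>b\<close> receives
      label \<open>k\<close>, the inner end becomes its parent.\<close>
    obtain a b where ab: "(a, b) \<in> parcs G" "a \<in> e ` {..<k}" "b \<notin> e ` {..<k}"
      using rtrancl_leaves_set[OF conn[OF assms(2) v(1)] \<open>w \<in> e ` {..<k}\<close> v(2)] by blast
    then obtain j where j: "j < k" "a = e j" by auto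
    show ?case
    proof (intro exI conjI ballI)
      show "(fun_upd e k b) 0 = w" using Suc.hyps e(1) by simp
      show "inj_on (fun_upd e k b) {..<Suc k}"
        using e(2) ab(3) by (auto simp: lessThan_Suc inj_on_def)
      show "fun_upd e k b ` {..<Suc k} \<subseteq> pverts G"
        using e(3) in_arcsD2[OF ab(1)] by (auto simp: lessThan_Suc)
      fix i assume i: "i \<in> {0<..<Suc k}"
      show "(fun_upd q k j) i < i"
        using i j(1) q[of i] by (auto simp: less_Suc_eq)
      show "(fun_upd e k b i, fun_upd e k b (fun_upd q k j i)) \<in> parcs G"
        using i j q[of i] arcs_symmetric[OF ab(1)] by (cases "i = k") auto
    qed
  qed
  moreover have "1 \<le> n" using assms(2) by (auto simp: n_def Suc_le_eq card_gt_0_iff)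
  ultimately have "\<exists>e q. e 0 = w \<and> inj_on e {..<n} \<and> e ` {..<n} \<subseteq> pverts G \<and>
      (\<forall>i\<in>{0<..<n}. q i < i \<and> (e i, e (q i)) \<in> parcs G)" by blast
  then obtain e q where e: "e 0 = w" "inj_on e {..<n}" "e ` {..<n} \<subseteq> pverts G"
      and q: "\<And>i. i \<in> {0<..<n} \<Longrightarrow> q i < i \<and> (e i, e (q i)) \<in> parcs G"
    by blast
  have "e ` {..<n} = pverts G"
    using e(2,3) by (intro card_subset_eq) (auto simp: card_image n_def)
  then have bij: "bij_betw e {..<n} (pverts G)" using e(2) by (simp add: bij_betw_def)
  \<comment> \<open>Only the arcs found by the search. This subgraph is connected and spanning, so
    acyclicity of \<open>G\<close> leaves no further arcs.\<close>
  define H where "H = \<lparr>pverts = pverts G,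
    parcs = (\<Union>i\<in>{0<..<n}. {(e i, e (q i)), (e (q i), e i)})\<rparr>"
  interpret H: labelled_tree n q H e
    using \<open>1 \<le> n\<close> q bij by unfold_locales (auto simp: H_def)
  have "parcs H \<subseteq> parcs G" using q arcs_symmetric by (auto simp: H_def)
  moreover have "(x, y) \<in> parcs H" if "(x, y) \<in> parcs G" for x y
  proof (rule tree_arc_in_connected_subgraph[OF assms(1)])
    show "pair_wf_digraph H"
      using H.pair_graph_G by (simp add: pair_graph_def pair_digraph_def pair_fin_digraph_def)
    show "(x, y) \<in> (parcs H)\<^sup>*"
      using that in_arcsD1 in_arcsD2 by (intro H.connected_G) (auto simp: H_def)
  qed (use that \<open>parcs H \<subseteq> parcs G\<close> in \<open>auto simp: H_def\<close>)
  ultimately have "parcs G = parcs H" by auto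
  then have "G = H" by (intro pair_pre_digraph.equality) (simp_all add: H_def)
  then show ?thesis using H.labelled_tree_axioms e(1) n_def by metis
qed

section \<open>Extremal trees\<close>

text \<open>Tails and heads of a pair graph are \<open>fst\<close> and \<open>snd\<close>, so the
  vertex map of an isomorphism determines its arc map.\<close>

lemma graph_iso_iff:
  assumes "pair_wf_digraph G"
  shows "graph_iso G H \<longleftrightarrow>
    (\<exists>f. bij_betw f (pverts G) (pverts H) \<and> parcs H = map_prod f f ` parcs G)"
proof
  assume "graph_iso G H"
  then obtain f where f: "pre_digraph.digraph_isomorphism (with_proj G) f"
      and H: "with_proj H = app_iso f (with_proj G)"
    unfolding digraph_iso_def by blast
  let ?f = "iso_verts f"
  have "verts (with_proj H) = ?f ` pverts G" "arcs (with_proj H) = iso_arcs f ` parcs G"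
      "tail (with_proj H) = iso_tail f" "head (with_proj H) = iso_head f"
    unfolding H by simp_all
  then have H': "pverts H = ?f ` pverts G" "parcs H = iso_arcs f ` parcs G"
      "iso_tail f = fst" "iso_head f = snd" by simp_all
  have "inj_on ?f (pverts G)" using f by (simp add: pre_digraph.digraph_isomorphism_def)
  moreover have "iso_arcs f a = map_prod ?f ?f a" if "a \<in> parcs G" for a
    using f that H'(3,4)
    by (auto simp: pre_digraph.digraph_isomorphism_def prod_eq_iff)
  then have "parcs H = map_prod ?f ?f ` parcs G" unfolding H'(2) by (intro image_cong) auto
  ultimately show "\<exists>f. bij_betw f (pverts G) (pverts H) \<and> parcs H = map_prod f f ` parcs G"
    using H'(1) by (intro exI[of _ ?f]) (simp add: bij_betw_def)
next
  assume "\<exists>f. bij_betw f (pverts G) (pverts H) \<and> parcs H = map_prod f f ` parcs G"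
  then obtain f where f: "inj_on f (pverts G)" "f ` pverts G = pverts H"
      and arcs: "parcs H = map_prod f f ` parcs G"
    by (auto simp: bij_betw_def)
  define F where "F = \<lparr>iso_verts = f, iso_arcs = map_prod f f, iso_head = snd, iso_tail = fst\<rparr>"
  interpret pair_wf_digraph G by (fact assms)
  have "inj_on (map_prod f f) (pverts G \<times> pverts G)" using f(1) by (rule map_prod_inj_on) fact
  then have "inj_on (map_prod f f) (parcs G)"
    by (rule inj_on_subset) (auto dest: in_arcsD1 in_arcsD2)
  then have "pre_digraph.digraph_isomorphism (with_proj G) F"
    using f(1) wf_digraph_wp_iff[of G] assms
    by (auto simp: pre_digraph.digraph_isomorphism_def F_def)
  moreover have "with_proj H = app_iso F (with_proj G)"
    using f(2) arcs by (intro pre_digraph.equality) (simp_all add: F_def)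
  ultimately show "graph_iso G H" unfolding digraph_iso_def by blast
qed

lemma is_tree_wf: "is_tree G \<Longrightarrow> pair_wf_digraph G"
  by (simp add: is_tree_def pair_graph_def pair_digraph_def pair_fin_digraph_def)

text \<open>Allows a closed form of the parent map to replace \<open>q\<close> when the two agree on
  the positive labels below \<open>n\<close>.\<close>

lemma labelled_tree_cong:
  assumes "labelled_tree n q G e" "\<And>i. 0 < i \<Longrightarrow> i < n \<Longrightarrow> q i = q' i"
  shows "labelled_tree n q' G e"
proof -
  interpret labelled_tree n q G e by (fact assms(1))
  show ?thesis
  proof
    show "q' i < i" if "0 < i" "i < n" for i
      using parent_less[OF that] assms(2)[OF that] by simp
    show "parcs G = (\<Union>i\<in>{0<..<n}. {(e i, e (q' i)), (e (q' i), e i)})"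
      unfolding arcs using assms(2) by auto
  qed (fact n_pos bij)+
qed

text \<open>An isomorphism pulls a labelling back without changing the parent map; conversely, two
  labellings with the same parent map compose to an isomorphism.\<close>

lemma labelled_tree_graph_iso_iff:
  assumes H: "labelled_tree n q H e'" and "pair_wf_digraph G"
  shows "graph_iso G H \<longleftrightarrow> (\<exists>e. labelled_tree n q G e)"
proof
  interpret H: labelled_tree n q H e' by (fact H)
  assume "graph_iso G H"
  then obtain f where f: "bij_betw f (pverts G) (pverts H)" "parcs H = map_prod f f ` parcs G"
    unfolding graph_iso_iff[OF assms(2)] by blast
  interpret pair_wf_digraph G by (fact assms(2))
  define g where "g = the_inv_into (pverts G) f"
  have g: "g (f x) = x" if "x \<in> pverts G" for x
    using f(1) that by (simp add: g_def bij_betw_def the_inv_into_f_f)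
  have "labelled_tree n q G (g \<circ> e')"
  proof
    show "bij_betw (g \<circ> e') {..<n} (pverts G)"
      unfolding g_def using H.bij f(1) by (intro bij_betw_trans bij_betw_the_inv_into)
    have "map_prod g g (map_prod f f a) = a" if "a \<in> parcs G" for a
      using g arc_fst_in_verts[OF that] arc_snd_in_verts[OF that] by (simp add: prod_eq_iff)
    then have "parcs G = map_prod g g ` parcs H"
      unfolding f(2) image_image by simp
    then show "parcs G = (\<Union>i\<in>{0<..<n}. {((g \<circ> e') i, (g \<circ> e') (q i)), ((g \<circ> e') (q i), (g \<circ> e') i)})"
      unfolding H.arcs by (simp add: image_UN)
  qed
  then show "\<exists>e. labelled_tree n q G e" by blast
next
  interpret H: labelled_tree n q H e' by (fact H)
  assume "\<exists>e. labelled_tree n q G e"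
  then obtain e where "labelled_tree n q G e" by blast
  then interpret G: labelled_tree n q G e .
  define f where "f = e' \<circ> the_inv_into {..<n} e"
  have f: "f (e i) = e' i" if "i < n" for i
    using that G.bij by (simp add: f_def bij_betw_def the_inv_into_f_f)
  have "bij_betw f (pverts G) (pverts H)"
    unfolding f_def by (rule bij_betw_trans[OF bij_betw_the_inv_into[OF G.bij] H.bij])
  moreover have "parcs H = map_prod f f ` parcs G"
    unfolding H.arcs G.arcs image_UN using G.parent_lt f by (intro SUP_cong) simp_all
  ultimately show "graph_iso G H"
    unfolding graph_iso_iff[OF assms(2)] by blast
qed

lemma labelled_tree_star_graph: "1 \<le> n \<Longrightarrow> labelled_tree n (\<lambda>_. 0) (star_graph n) (\<lambda>i. i)"
  by unfold_locales (auto simp: star_graph_def bij_betw_def)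

lemma labelled_tree_path_graph: "1 \<le> n \<Longrightarrow> labelled_tree n (\<lambda>i. i - 1) (path_graph n) (\<lambda>i. i)"
  by unfold_locales (auto simp: path_graph_def bij_betw_def)

section \<open>Bounds for \<open>T_meet\<close> and their equality cases\<close>

lemma T_meet_attained:
  assumes "is_tree G"
  shows "\<exists>w\<in>pverts G. T_meet G = stationary_hitting_time G w"
    and "w \<in> pverts G \<Longrightarrow> stationary_hitting_time G w \<le> T_meet G"
proof -
  interpret pair_graph G using assms by (simp add: is_tree_def)
  have "pverts G \<noteq> {}"
    using assms pair_graph_connected_iff[OF pair_graph] by (simp add: is_tree_def)
  then have "T_meet G \<in> stationary_hitting_time G ` pverts G"
    unfolding T_meet_def using pair_finite_verts by (intro Max_in) auto
  then show "\<exists>w\<in>pverts G. T_meet G = stationary_hitting_time G w" by blast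
  show "stationary_hitting_time G w \<le> T_meet G" if "w \<in> pverts G"
    unfolding T_meet_def using that pair_finite_verts by simp
qed

lemma stationary_hitting_time_tree:
  assumes "is_tree G" "card (pverts G) = n" "2 \<le> n" "w \<in> pverts G"
  obtains e q where "labelled_tree n q G e" "e 0 = w"
    "stationary_hitting_time G w = ennreal (recursive_tree.cost n q / (2 * (real n - 1)))"
  using ex_labelled_tree[OF assms(1,4)] labelled_tree.stationary_hitting_time_root assms(2,3) by metis

lemma path_value:
  assumes "2 \<le> n"
  shows "(real n - 1) * (4 * (real n - 1)\<^sup>2 - 1) / 3 / (2 * (real n - 1)) =
    (4 * real n ^ 2 - 8 * real n + 3) / 6"
  using assms by (simp add: field_simps power2_eq_square)

text \<open>The numerator factors as \<open>(4 * n - 7) * (n - 1)\<close>.\<close>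

lemma star_value:
  assumes "2 \<le> n"
  shows "((2 * real n - 3)\<^sup>2 + (real n - 2)) / (2 * (real n - 1)) = 2 * real n - 7 / 2"
  using assms by (simp add: field_simps power2_eq_square)

text \<open>The cost bound is applied at a target attaining \<open>T_meet\<close>; equality makes
  the labelling rooted there a path. Conversely, an end of a path attains the bound.\<close>

lemma
  assumes "is_tree G" "card (pverts G) = n" "2 \<le> n"
  shows T_meet_le_path: "T_meet G \<le> ennreal ((4 * real n ^ 2 - 8 * real n + 3) / 6)" (is ?le)
    and T_meet_path_iff: "T_meet G = ennreal ((4 * real n ^ 2 - 8 * real n + 3) / 6) \<longleftrightarrow>
      (\<exists>e. labelled_tree n (\<lambda>i. i - 1) G e)" (is ?iff)
proof -
  let ?P = "(real n - 1) * (4 * (real n - 1)\<^sup>2 - 1) / 3"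
  have pos: "0 < 2 * (real n - 1)" using assms(3) by simp
  have "4 * 1\<^sup>2 \<le> 4 * (real n - 1)\<^sup>2" using assms(3) by (intro mult_left_mono power_mono) auto
  then have "0 \<le> 4 * (real n - 1)\<^sup>2 - 1" by simp
  then have P_nonneg: "0 \<le> ?P"
    using pos by (intro divide_nonneg_nonneg mult_nonneg_nonneg) auto
  obtain w where w: "w \<in> pverts G" "T_meet G = stationary_hitting_time G w"
    using T_meet_attained(1)[OF assms(1)] by blast
  obtain e q where "labelled_tree n q G e" "e 0 = w"
    and T: "T_meet G = ennreal (recursive_tree.cost n q / (2 * (real n - 1)))"
    using stationary_hitting_time_tree[OF assms w(1)] w(2) by metis
  interpret labelled_tree n q G e by fact
  show ?le
    unfolding T path_value[OF assms(3), symmetric] using cost_le_path pos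
    by (intro ennreal_leI divide_right_mono) auto
  have cost_nonneg: "0 \<le> cost" unfolding cost_def by (intro sum_nonneg) simp
  show ?iff
  proof
    assume "T_meet G = ennreal ((4 * real n ^ 2 - 8 * real n + 3) / 6)"
    \<comment> \<open>\<open>ennreal\<close> sends all negative reals to 0, so removing it relies on
      both sides being nonnegative.\<close>
    then have "cost / (2 * (real n - 1)) = ?P / (2 * (real n - 1))"
      unfolding T path_value[OF assms(3), symmetric]
      using cost_nonneg P_nonneg pos by (subst (asm) ennreal_inj) (auto intro!: divide_nonneg_pos)
    then have "cost = ?P" using pos by (metis divide_cancel_right less_irrefl)
    then have "labelled_tree n (\<lambda>i. i - 1) G e"
      unfolding cost_path_iff by (intro labelled_tree_cong[OF labelled_tree_axioms]) auto
    then show "\<exists>e. labelled_tree n (\<lambda>i. i - 1) G e" by blast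
  next
    assume "\<exists>e. labelled_tree n (\<lambda>i. i - 1) G e"
    then obtain e' where "labelled_tree n (\<lambda>i. i - 1) G e'" by blast
    then interpret P: labelled_tree n "\<lambda>i. i - 1" G e' .
    have "P.cost = ?P" unfolding P.cost_path_iff by simp
    then have "stationary_hitting_time G (e' 0) = ennreal ((4 * real n ^ 2 - 8 * real n + 3) / 6)"
      unfolding P.stationary_hitting_time_root[OF assms(3)] path_value[OF assms(3), symmetric]
      by (simp only:)
    then show "T_meet G = ennreal ((4 * real n ^ 2 - 8 * real n + 3) / 6)"
      using \<open>?le\<close> T_meet_attained(2)[OF assms(1) P.e_in[OF n_pos]] by simp
  qed
qed

text \<open>Every edge of a star contains the centre. Hence any labelling of a star has the centre
  at the root, with cost \<open>n - 1\<close>, or at label \<open>1\<close>, with the cost of a leaf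
  as target.\<close>

lemma labelled_star_value:
  assumes star: "labelled_tree n (\<lambda>_. 0) G c" and "labelled_tree n q G e" "2 \<le> n"
  shows "recursive_tree.cost n q \<le> (2 * real n - 3)\<^sup>2 + (real n - 2)"
proof -
  interpret S: labelled_tree n "\<lambda>_. 0" G c by (fact star)
  interpret labelled_tree n q G e by fact
  have hub: "x = c 0 \<or> y = c 0" if "(x, y) \<in> parcs G" for x y
    using that by (rule S.parcsE) auto
  have arc: "(e i, e (q i)) \<in> parcs G" if "0 < i" "i < n" for i
    using that unfolding arcs by auto
  show ?thesis
  proof (cases "e 0 = c 0")
    case True
    have "q i = 0" if "0 < i" "i < n" for i
      using hub[OF arc[OF that]] e_eq_iff[of i 0] e_eq_iff[of "q i" 0] True that parent_lt[OF that] n_pos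
      by auto
    then have "cost = real n - 1" by (rule cost_star_center)
    moreover have "1 \<le> (2 * real n - 3)\<^sup>2" using assms(3) by (intro one_le_power) simp
    ultimately show ?thesis by simp
  next
    case False
    \<comment> \<open>The edge between the labels \<open>0\<close> and \<open>1\<close> contains the
      centre, which is not at the root.\<close>
    have "q 1 = 0" using parent_less[of 1] assms(3) by simp
    then have c: "e 1 = c 0" using hub[OF arc[of 1]] assms(3) False by auto
    have q1: "q i = 1" if "1 < i" "i < n" for i
      using hub[OF arc[of i]] e_eq_iff[of i 1] e_eq_iff[of "q i" 1] c that parent_lt[of i]
      by auto
    then show ?thesis
      using cost_star_iff[OF assms(3)] by simp
  qed
qed

text \<open>A single leaf as target already gives the lower bound, and equality for
  \<open>T_meet\<close> forces equality at this leaf. Conversely, \<open>labelled_star_value\<close>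
  bounds all targets of a star from above.\<close>

lemma
  assumes "is_tree G" "card (pverts G) = n" "2 \<le> n"
  shows T_meet_ge_star: "ennreal (2 * real n - 7 / 2) \<le> T_meet G" (is ?ge)
    and T_meet_star_iff: "T_meet G = ennreal (2 * real n - 7 / 2) \<longleftrightarrow>
      (\<exists>e. labelled_tree n (\<lambda>_. 0) G e)" (is ?iff)
proof -
  let ?S = "(2 * real n - 3)\<^sup>2 + (real n - 2)"
  have pos: "0 < 2 * (real n - 1)" using assms(3) by simp
  have S_nonneg: "0 \<le> ?S" using assms(3) by simp
  obtain w where "w \<in> pverts G" using T_meet_attained(1)[OF assms(1)] by blast
  then obtain e q where "labelled_tree n q G e"
    using ex_labelled_tree[OF assms(1)] assms(2) by metis
  then interpret labelled_tree n q G e .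
  \<comment> \<open>Parents have smaller labels than their children, so the last label has no child
    and belongs to a leaf.\<close>
  define l where "l = e (n - 1)"
  have l: "l \<in> pverts G" using n_pos by (simp add: l_def e_in)
  have "k \<notin> children (n - 1)" for k
    using parent_less[of k] by (auto simp: children_def)
  then have "children (n - 1) = {}" by blast
  then have "card (neighbors G l) = 1"
    using card_neighbors_e[of "n - 1"] assms(3) by (simp add: l_def deg_def)
  obtain e' q' where "labelled_tree n q' G e'" and e': "e' 0 = l"
    and sht: "stationary_hitting_time G l =
      ennreal (recursive_tree.cost n q' / (2 * (real n - 1)))"
    using stationary_hitting_time_tree[OF assms l] by metis
  then interpret L: labelled_tree n q' G e' by simp
  have "card (L.children 0) = 1"
    using \<open>card (neighbors G l) = 1\<close> L.card_neighbors_e[OF n_pos] e' by (simp add: L.deg_def)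
  moreover have "1 \<in> L.children 0"
    using L.parent_less[of 1] assms(3) by (auto simp: L.children_def)
  ultimately have "L.children 0 = {1}" by (metis card_1_singletonE singletonD)
  then have leaf: "q' i \<noteq> 0" if "1 < i" "i < n" for i
  proof -
    have "i \<notin> L.children 0" using \<open>L.children 0 = {1}\<close> that by simp
    then show ?thesis using that by (simp add: L.children_def)
  qed
  have "?S / (2 * (real n - 1)) \<le> L.cost / (2 * (real n - 1))"
    using L.cost_ge_star[OF assms(3) leaf] pos by (intro divide_right_mono) auto
  then have ge: "ennreal (2 * real n - 7 / 2) \<le> stationary_hitting_time G l"
    unfolding sht star_value[OF assms(3), symmetric] by (rule ennreal_leI)
  then show ?ge using T_meet_attained(2)[OF assms(1) l] by (rule order_trans)
  show ?iff
  proof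
    assume "T_meet G = ennreal (2 * real n - 7 / 2)"
    then have "stationary_hitting_time G l = ennreal (2 * real n - 7 / 2)"
      using ge T_meet_attained(2)[OF assms(1) l] by simp
    moreover have "0 \<le> L.cost" unfolding L.cost_def by (intro sum_nonneg) simp
    ultimately have "L.cost / (2 * (real n - 1)) = ?S / (2 * (real n - 1))"
      unfolding sht star_value[OF assms(3), symmetric]
      using S_nonneg pos by (subst (asm) ennreal_inj) (auto intro!: divide_nonneg_pos)
    then have "L.cost = ?S" using pos by (metis divide_cancel_right less_irrefl)
    then have q1: "q' i = 1" if "1 < i" "i < n" for i
      using L.cost_star_iff[OF assms(3) leaf] that by blast
    \<comment> \<open>The root \<open>l\<close> is a leaf and the centre carries label
      \<open>1\<close>; exchanging the two labels moves the centre to the root.\<close>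
    let ?t = "Transposition.transpose 0 (1::nat)"
    have "labelled_tree n (\<lambda>_. 0) G (e' \<circ> ?t)"
    proof
      have "bij_betw ?t {..<n} {..<n}"
        by (rule bij_betw_byWitness[where f'="?t"])
          (use assms(3) in \<open>auto simp: Transposition.transpose_def\<close>)
      then show "bij_betw (e' \<circ> ?t) {..<n} (pverts G)"
        using L.bij by (rule bij_betw_trans)
      have "{0<..<n} = insert 1 {1<..<n}" using assms(3) by auto
      moreover have "q' 1 = 0" using L.parent_less[of 1] assms(3) by simp
      ultimately show "parcs G = (\<Union>i\<in>{0<..<n}. {((e' \<circ> ?t) i, (e' \<circ> ?t) 0), ((e' \<circ> ?t) 0, (e' \<circ> ?t) i)})"
        unfolding L.arcs using q1 by (auto simp: Transposition.transpose_def)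
    qed (use n_pos in auto)
    then show "\<exists>e. labelled_tree n (\<lambda>_. 0) G e" by blast
  next
    assume "\<exists>e. labelled_tree n (\<lambda>_. 0) G e"
    then obtain c where c: "labelled_tree n (\<lambda>_. 0) G c" by blast
    obtain w where w: "w \<in> pverts G" "T_meet G = stationary_hitting_time G w"
      using T_meet_attained(1)[OF assms(1)] by blast
    obtain e q where eq: "labelled_tree n q G e"
      and T: "T_meet G = ennreal (recursive_tree.cost n q / (2 * (real n - 1)))"
      using stationary_hitting_time_tree[OF assms w(1)] w(2) by metis
    have "T_meet G \<le> ennreal (2 * real n - 7 / 2)"
      unfolding T star_value[OF assms(3), symmetric]
      using labelled_star_value[OF c eq assms(3)] pos by (intro ennreal_leI divide_right_mono) auto
    then show "T_meet G = ennreal (2 * real n - 7 / 2)" using \<open>?ge\<close> by (rule antisym)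
  qed
qed

text \<open>Provides copies of the star and the path on \<open>V\<close>, so that the extremal
  values are attained inside \<open>trees_on V\<close>.\<close>

lemma ex_labelled_tree_on:
  assumes "card V = n" "recursive_tree n q"
  shows "\<exists>G e. labelled_tree n q G e \<and> G \<in> trees_on V"
proof -
  interpret recursive_tree n q by fact
  have "finite V" using assms(1) n_pos card_ge_0_finite by blast
  then obtain e where "bij_betw e {..<n} V"
    using assms(1) ex_bij_betw_nat_finite[of V] by (auto simp: atLeast0LessThan)
  then interpret labelled_tree n q "\<lparr>pverts = V, parcs = (\<Union>i\<in>{0<..<n}. {(e i, e (q i)), (e (q i), e i)})\<rparr>" e
    by unfold_locales auto
  show ?thesis
    using labelled_tree_axioms is_tree_G by (intro exI conjI) (auto simp: trees_on_def)
qed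

text \<open>Makes \<open>Min\<close> and \<open>Max\<close> over the family meaningful.\<close>

lemma finite_trees_on:
  assumes "finite V"
  shows "finite (trees_on V)"
proof (rule finite_subset)
  show "trees_on V \<subseteq> (\<lambda>A. \<lparr>pverts = V, parcs = A\<rparr>) ` Pow (V \<times> V)"
  proof
    fix G assume G: "G \<in> trees_on V"
    then interpret pair_wf_digraph G by (auto simp: trees_on_def intro: is_tree_wf)
    have "parcs G \<subseteq> V \<times> V" using G in_arcsD1 in_arcsD2 by (auto simp: trees_on_def)
    moreover have "G = \<lparr>pverts = V, parcs = parcs G\<rparr>" using G by (simp add: trees_on_def)
    ultimately show "G \<in> (\<lambda>A. \<lparr>pverts = V, parcs = A\<rparr>) ` Pow (V \<times> V)" by blast
  qed
qed (use assms in simp)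

theorem theorem1p9:
  fixes V :: "'a set" and n :: nat
  assumes "n \<ge> 2" and "card V = n"
  shows "is_tree (star_graph n) \<and> is_tree (path_graph n) \<and>
    Min (T_meet ` trees_on V) = T_meet (star_graph n) \<and>
    T_meet (star_graph n) = ennreal (2 * real n - 7 / 2) \<and>
    Max (T_meet ` trees_on V) = T_meet (path_graph n) \<and>
    T_meet (path_graph n) = ennreal ((4 * real n ^ 2 - 8 * real n + 3) / 6) \<and>
    (\<forall>G\<in>trees_on V. T_meet G = Min (T_meet ` trees_on V) \<longleftrightarrow> graph_iso G (star_graph n)) \<and>
    (\<forall>G\<in>trees_on V. T_meet G = Max (T_meet ` trees_on V) \<longleftrightarrow> graph_iso G (path_graph n))"
proof -
  have "finite V" using assms by (auto intro: card_ge_0_finite)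
  note fin = finite_imageI[OF finite_trees_on[OF this], of T_meet]
  interpret star: labelled_tree n "\<lambda>_. 0" "star_graph n" "\<lambda>i. i"
    using assms(1) by (intro labelled_tree_star_graph) simp
  interpret path: labelled_tree n "\<lambda>i. i - 1" "path_graph n" "\<lambda>i. i"
    using assms(1) by (intro labelled_tree_path_graph) simp
  have "card (pverts (star_graph n)) = n" "card (pverts (path_graph n)) = n"
    by (simp_all add: star_graph_def path_graph_def)
  then have star: "T_meet (star_graph n) = ennreal (2 * real n - 7 / 2)"
    and path: "T_meet (path_graph n) = ennreal ((4 * real n ^ 2 - 8 * real n + 3) / 6)"
    using T_meet_star_iff[OF star.is_tree_G _ assms(1)] T_meet_path_iff[OF path.is_tree_G _ assms(1)]
      star.labelled_tree_axioms path.labelled_tree_axioms by blast+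
  have tree: "is_tree G" "card (pverts G) = n" if "G \<in> trees_on V" for G
    using that assms(2) by (auto simp: trees_on_def)
  note bounds = T_meet_ge_star[OF tree assms(1)] T_meet_le_path[OF tree assms(1)]
  obtain S where S: "S \<in> trees_on V" "T_meet S = ennreal (2 * real n - 7 / 2)"
    using ex_labelled_tree_on[OF assms(2) star.recursive_tree_axioms]
      T_meet_star_iff[OF tree assms(1)] by metis
  obtain P where P: "P \<in> trees_on V" "T_meet P = ennreal ((4 * real n ^ 2 - 8 * real n + 3) / 6)"
    using ex_labelled_tree_on[OF assms(2) path.recursive_tree_axioms]
      T_meet_path_iff[OF tree assms(1)] by metis
  have Min: "Min (T_meet ` trees_on V) = ennreal (2 * real n - 7 / 2)"
    using fin bounds(1) S by (intro Min_eqI) (auto intro: rev_image_eqI)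
  have Max: "Max (T_meet ` trees_on V) = ennreal ((4 * real n ^ 2 - 8 * real n + 3) / 6)"
    using fin bounds(2) P by (intro Max_eqI) (auto intro: rev_image_eqI)
  \<comment> \<open>Both sides of each equivalence rewrite to the existence of a labelling of
    \<open>G\<close> with the parent map of the star or of the path.\<close>
  have "T_meet G = Min (T_meet ` trees_on V) \<longleftrightarrow> graph_iso G (star_graph n)"
    and "T_meet G = Max (T_meet ` trees_on V) \<longleftrightarrow> graph_iso G (path_graph n)"
    if "G \<in> trees_on V" for G
    unfolding Min Max T_meet_star_iff[OF tree[OF that] assms(1)]
      T_meet_path_iff[OF tree[OF that] assms(1)]
      labelled_tree_graph_iso_iff[OF star.labelled_tree_axioms is_tree_wf[OF tree(1)[OF that]]]
      labelled_tree_graph_iso_iff[OF path.labelled_tree_axioms is_tree_wf[OF tree(1)[OF that]]]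
    by (rule refl)+
  then show ?thesis
    using star.is_tree_G path.is_tree_G star path Min Max by simp
qed

end
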